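(* Let $n$ be a positive integer, let $\mathcal{M}$ be a non-zero closed subspace of the real Hardy space $H^2_{\mathbb{R}}(\mathbb{D})$ which is nearly $T_z^*$-invariant with defect $n$, and let $\{e_i\}_{i=1}^n$ be an orthonormal basis of the defect space. (i) If there exists a function in $\mathcal{M}$ which does not vanish at $0$, then there exists a closed $T_z^*\oplus T_z^*$-invariant subspace $\mathcal{N}$ of $H^2_{\mathbb{R}}(\mathbb{D})\oplus H^2_{\mathbb{R}}(\mathbb{D},\mathbb{C}^n)$ such that $$\mathcal{M}=\Big\{f=gh+z\sum_{i=1}^n h_ie_i : (h,h_1,\dots,h_n)\in\mathcal{N}\Big\},$$ where $g$ is the function of unit norm in $\mathcal{M}$, orthogonal to $\mathcal{M}\cap zH^2_{\mathbb{R}}(\mathbb{D})$, satisfying $g(0)>0$. Further, for all $f=gh+z\sum_{i=1}^n h_ie_i\in\mathcal{M}$ with $(h,h_1,\dots,h_n)\in\mathcal{N}$, $$\|f\|^2=\|h\|^2+\sum_{i=1}^n\|h_i\|^2.$$ (ii) If all functions in $\mathcal{M}$ vanish at $0$, then there exists a closed $T_z^*$-invariant subspace $\mathcal{N}$ of $H^2_{\mathbb{R}}(\mathbb{D},\mathbb{C}^n)$ such that $$\mathcal{M}=\Big\{f=z\sum_{i=1}^n h_ie_i : (h_1,\dots,h_n)\in\mathcal{N}\Big\}.$$ Further, for all $f=z\sum_{i=1}^n h_ie_i\in\mathcal{M}$ with $(h_1,\dots,h_n)\in\mathcal{N}$, $$\|f\|^2=\sum_{i=1}^n\|h_i\|^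2.$$
   Context: $\mathbb{D}$ is the open unit disc. $H^2(\mathbb{D},\mathbb{C}^m)$ is the Hardy space of power series $F(z)=\sum_{k\ge0}A_kz^k$ with $A_k\in\mathbb{C}^m$ and $\sum\|A_k\|^2<\infty$, with inner product $\langle \sum A_kz^k,\sum B_kz^k\rangle=\sum\langle A_k,B_k\rangle_{\mathbb{C}^m}$. The real Hardy space $H^2_{\mathbb{R}}(\mathbb{D},\mathbb{C}^m)$ is the set of $F\in H^2(\mathbb{D},\mathbb{C}^m)$ with all $A_k\in\mathbb{R}^m$; it is a real Hilbert space with the same inner product, and its elements are identified with $m$-tuples $(f_1,\dots,f_m)$ of elements of $H^2_{\mathbb{R}}(\mathbb{D}):=H^2_{\mathbb{R}}(\mathbb{D},\mathbb{C}^1)$. "Subspace" of a real Hardy space (or of a direct sum of such) means closed real-linear subspace. The backward shift is $(T_z^*F)(z)=\frac{F(z)-F(0)}{z}$ on each $H^2_{\mathbb{R}}(\mathbb{D},\mathbb{C}^m)$, and $T_z^*\oplus T_z^*$ acts coordinatewise on the orthogonal direct sum. A subspace $\mathcal{M}$ of $H^2_{\mathbb{R}}(\mathbb{D})$ is nearly $T_z^*$-invariant with (finite) defect if there is a finite-dimensional subspace $\mathcal{F}$ of $H^2_{\mathbb{R}}(\mathbb{D})$, orthogonal to $\mathcal{M}$, such that $T_z^*(\mathcal{M}\cap zH^2_{\mathbb{R}}(\mathbb{D}))\subset\mathcal{M}\oplus\mathcal{F}$. An $\mathcal{F}$ of smallest dimension with this property is called the defect space of $\mathcal{M}$, and its dimension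 is called the defect of $\mathcal{M}$. *)

theory Defs
  imports "HOL-Analysis.Analysis"
begin

section \<open>Real Hardy spaces\<close>

text \<open>
  The real Hardy space \<open>H\<^sup>2\<^sub>\<real>(\<D>, \<complex>\<^sup>m)\<close> consists of the power series
  \<open>\<Sum> A\<^sub>k z\<^sup>k\<close> with \<open>A\<^sub>k \<in> \<real>\<^sup>m\<close> and \<open>\<Sum> \<parallel>A\<^sub>k\<parallel>\<^sup>2 < \<infinity>\<close>. Here it is the type
  \<open>(real ^ 'm) hardy\<close>, and the scalar space \<open>H\<^sup>2\<^sub>\<real>(\<D>)\<close> is \<open>real hardy\<close>.
  Since the coefficients are real, the norms and inner products of \<open>\<complex>\<^sup>m\<close> restrict to those of
  \<open>\<real>\<^sup>m\<close>. Each such series converges on the open unit disc (lemma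
  \<open>hardy_conv_radius\<close> below), so that the ring operations on formal power series
  correspond to the pointwise ones on functions on the disc, and \<open>F(0)\<close> is the coefficient of
  index \<open>0\<close>.
\<close>

lemma summable_square_add:
  fixes a b :: "nat \<Rightarrow> 'a::real_normed_vector"
  assumes a: "summable (\<lambda>k. (norm (a k))\<^sup>2)" and b: "summable (\<lambda>k. (norm (b k))\<^sup>2)"
  shows "summable (\<lambda>k. (norm (a k + b k))\<^sup>2)"
proof (rule summable_comparison_test')
  show "summable (\<lambda>k. 2 * (norm (a k))\<^sup>2 + 2 * (norm (b k))\<^sup>2)"
    by (intro summable_add summable_mult a b)
  fix k :: nat
  have "(norm (a k + b k))\<^sup>2 \<le> (norm (a k) + norm (b k))\<^sup>2"
    by (intro power_mono norm_triangle_ineq) simp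
  also have "\<dots> \<le> 2 * (norm (a k))\<^sup>2 + 2 * (norm (b k))\<^sup>2"
    using sum_squares_bound[of "norm (a k)" "norm (b k)"] by (simp add: power2_sum)
  finally show "norm ((norm (a k + b k))\<^sup>2) \<le> 2 * (norm (a k))\<^sup>2 + 2 * (norm (b k))\<^sup>2"
    by simp
qed

lemma summable_square_inner:
  fixes a b :: "nat \<Rightarrow> 'a::real_inner"
  assumes a: "summable (\<lambda>k. (norm (a k))\<^sup>2)" and b: "summable (\<lambda>k. (norm (b k))\<^sup>2)"
  shows "summable (\<lambda>k. a k \<bullet> b k)"
proof (rule summable_comparison_test')
  show "summable (\<lambda>k. (norm (a k))\<^sup>2 + (norm (b k))\<^sup>2)"
    by (intro summable_add a b)
  fix k :: nat
  have "\<bar>a k \<bullet> b k\<bar> \<le> norm (a k) * norm (b k)"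
    by (rule Cauchy_Schwarz_ineq2)
  also have "\<dots> \<le> 2 * norm (a k) * norm (b k)"
    by simp
  also have "\<dots> \<le> (norm (a k))\<^sup>2 + (norm (b k))\<^sup>2"
    by (rule sum_squares_bound)
  finally show "norm (a k \<bullet> b k) \<le> (norm (a k))\<^sup>2 + (norm (b k))\<^sup>2"
    by simp
qed

typedef (overloaded) 'a hardy =
    "{F :: 'a::real_inner fps. summable (\<lambda>k. (norm (fps_nth F k))\<^sup>2)}"
  morphisms power_series Abs_hardy
  by (rule exI[of _ 0]) simp

setup_lifting type_definition_hardy

instantiation hardy :: (real_inner) real_vector
begin

lift_definition zero_hardy :: "'a hardy" is 0
  by simp

lift_definition plus_hardy :: "'a hardy \<Rightarrow> 'a hardy \<Rightarrow> 'a hardy" is "(+)"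
  by (simp add: summable_square_add)

lift_definition uminus_hardy :: "'a hardy \<Rightarrow> 'a hardy" is uminus
  by simp

lift_definition minus_hardy :: "'a hardy \<Rightarrow> 'a hardy \<Rightarrow> 'a hardy" is "(-)"
  subgoal for F G
    using summable_square_add[of "fps_nth F" "\<lambda>k. - fps_nth G k"] by simp
  done

lift_definition scaleR_hardy :: "real \<Rightarrow> 'a hardy \<Rightarrow> 'a hardy"
  is "\<lambda>c F. Abs_fps (\<lambda>k. c *\<^sub>R fps_nth F k)"
  by (simp add: power_mult_distrib summable_mult)

instance
proof
  fix F G H :: "'a hardy" and c d :: real
  show "F + G + H = F + (G + H)" by transfer (simp add: add.assoc)
  show "F + G = G + F" by transfer (simp add: add.commute)
  show "0 + F = F" by transfer simp
  show "- F + F = 0" by transfer simp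
  show "F - G = F + - G" by transfer simp
  show "c *\<^sub>R (F + G) = c *\<^sub>R F + c *\<^sub>R G"
    by transfer (simp add: fps_eq_iff scaleR_add_right)
  show "(c + d) *\<^sub>R F = c *\<^sub>R F + d *\<^sub>R F"
    by transfer (simp add: fps_eq_iff scaleR_add_left)
  show "c *\<^sub>R d *\<^sub>R F = (c * d) *\<^sub>R F" by transfer (simp add: fps_eq_iff)
  show "1 *\<^sub>R F = F" by transfer (simp add: fps_eq_iff)
qed

end

instantiation hardy :: (real_inner) real_inner
begin

lift_definition inner_hardy :: "'a hardy \<Rightarrow> 'a hardy \<Rightarrow> real"
  is "\<lambda>F G. \<Sum>k. fps_nth F k \<bullet> fps_nth G k" .

definition norm_hardy :: "'a hardy \<Rightarrow> real"
  where "norm_hardy F = sqrt (F \<bullet> F)"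

definition dist_hardy :: "'a hardy \<Rightarrow> 'a hardy \<Rightarrow> real"
  where "dist_hardy F G = norm (F - G)"

definition sgn_hardy :: "'a hardy \<Rightarrow> 'a hardy"
  where "sgn_hardy F = F /\<^sub>R norm F"

definition uniformity_hardy :: "('a hardy \<times> 'a hardy) filter"
  where "uniformity_hardy = (INF e\<in>{0<..}. principal {(F, G). dist F G < e})"

definition open_hardy :: "'a hardy set \<Rightarrow> bool"
  where "open_hardy U \<longleftrightarrow> (\<forall>F\<in>U. \<forall>\<^sub>F (F', G) in uniformity. F' = F \<longrightarrow> G \<in> U)"

instance
proof
  fix F G H :: "'a hardy" and c d :: real
  show "dist F G = norm (F - G)" by (fact dist_hardy_def)
  show "sgn F = F /\<^sub>R norm F" by (fact sgn_hardy_def)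
  show "uniformity = (INF e\<in>{0<..}. principal {(F, G :: 'a hardy). dist F G < e})"
    by (fact uniformity_hardy_def)
  show "open U \<longleftrightarrow> (\<forall>F\<in>U. \<forall>\<^sub>F (F', G) in uniformity. F' = F \<longrightarrow> G \<in> U)" for U :: "'a hardy set"
    by (fact open_hardy_def)
  show "F \<bullet> G = G \<bullet> F" by transfer (simp add: inner_commute)
  show "(F + G) \<bullet> H = F \<bullet> H + G \<bullet> H"
    by transfer (simp add: inner_add_left suminf_add summable_square_inner)
  show "(c *\<^sub>R F) \<bullet> G = c * (F \<bullet> G)"
    by transfer (simp add: suminf_mult summable_square_inner)
  show "0 \<le> F \<bullet> F"
    by transfer (simp add: suminf_nonneg power2_norm_eq_inner)
  show "F \<bullet> F = 0 \<longleftrightarrow> F = 0"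
    by transfer (simp add: power2_norm_eq_inner suminf_eq_zero_iff fps_eq_iff)
  show "norm F = sqrt (F \<bullet> F)" by (fact norm_hardy_def)
qed

end

lemma hardy_conv_radius:
  fixes F :: "real hardy"
  shows "fps_conv_radius (Abs_fps (\<lambda>k. complex_of_real (fps_nth (power_series F) k))) \<ge> 1"
proof -
  let ?a = "\<lambda>k. fps_nth (power_series F) k"
  have "summable (\<lambda>k. (norm (?a k))\<^sup>2)"
    using power_series[of F] by simp
  hence "(\<lambda>k. (norm (?a k))\<^sup>2) \<longlonglongrightarrow> 0"
    by (rule summable_LIMSEQ_zero)
  hence "(\<lambda>k. sqrt ((norm (?a k))\<^sup>2)) \<longlonglongrightarrow> sqrt 0"
    by (rule tendsto_real_sqrt)
  hence lim: "?a \<longlonglongrightarrow> 0"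
    by (simp add: tendsto_rabs_zero_iff)
  have "conv_radius (\<lambda>k. complex_of_real (?a k)) \<ge> 1"
  proof (rule conv_radius_geI_ex')
    fix r :: real assume r: "0 < r" "ereal r < 1"
    have "Bseq ?a"
      using lim by (intro convergent_imp_Bseq convergentI)
    then obtain K where K: "norm (?a k) \<le> K" for k
      unfolding Bseq_def by blast
    show "summable (\<lambda>k. complex_of_real (?a k) * complex_of_real r ^ k)"
    proof (rule summable_comparison_test')
      show "summable (\<lambda>k. K * r ^ k)"
        using r by (intro summable_mult summable_geometric) (simp add: one_ereal_def)
      show "norm (complex_of_real (?a k) * complex_of_real r ^ k) \<le> K * r ^ k" for k
        using K[of k] r by (simp add: norm_mult norm_power mult_right_mono)
    qed
  qed
  thus ?thesis by (simp add: fps_conv_radius_def)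
qed

text \<open>The identification of \<open>F \<in> H\<^sup>2\<^sub>\<real>(\<D>, \<complex>\<^sup>m)\<close> with the tuple \<open>(f\<^sub>1, \<dots>, f\<^sub>m)\<close>.\<close>

lift_definition component :: "'m::finite \<Rightarrow> (real ^ 'm) hardy \<Rightarrow> real hardy"
  is "\<lambda>i F. Abs_fps (\<lambda>k. fps_nth F k $ i)"
proof -
  fix i :: 'm and F :: "(real ^ 'm) fps"
  assume F: "summable (\<lambda>k. (norm (fps_nth F k))\<^sup>2)"
  have "(norm (fps_nth F k $ i))\<^sup>2 \<le> (norm (fps_nth F k))\<^sup>2" for k
    by (intro power_mono Finite_Cartesian_Product.norm_nth_le) simp
  then have "summable (\<lambda>k. (norm (fps_nth F k $ i))\<^sup>2)"
    by (intro summable_comparison_test'[OF F, of 0]) simp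
  then show "summable (\<lambda>k. (norm (fps_nth (Abs_fps (\<lambda>k. fps_nth F k $ i)) k))\<^sup>2)"
    by simp
qed

text \<open>\<open>fps_shift 1 F\<close> is \<open>(F(z) - F(0)) / z\<close>.\<close>

lift_definition backward_shift :: "'a::real_inner hardy \<Rightarrow> 'a hardy" is "fps_shift 1"
proof -
  fix F :: "'a fps"
  assume F: "summable (\<lambda>k. (norm (fps_nth F k))\<^sup>2)"
  show "summable (\<lambda>k. (norm (fps_nth (fps_shift 1 F) k))\<^sup>2)"
    using summable_ignore_initial_segment[OF F, of 1] by simp
qed

definition zH2 :: "real hardy set"
  where "zH2 = {f. \<exists>h :: real hardy. power_series f = fps_X * power_series h}"


section \<open>Nearly invariant subspaces with finite defect\<close>

text \<open>
  As \<open>dim\<close> is \<open>0\<close> on infinite-dimensional spaces, finite dimension is required separately. The sum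
  of \<open>M\<close> and \<open>F\<close> is automatically direct, by orthogonality.
\<close>

definition near_invariance_space :: "real hardy set \<Rightarrow> real hardy set \<Rightarrow> bool"
  where "near_invariance_space M F \<longleftrightarrow>
    subspace F \<and> (\<exists>B. finite B \<and> F = span B) \<and>
    (\<forall>f\<in>M. \<forall>u\<in>F. orthogonal f u) \<and>
    backward_shift ` (M \<inter> zH2) \<subseteq> {f + u | f u. f \<in> M \<and> u \<in> F}"

definition defect_space :: "real hardy set \<Rightarrow> real hardy set \<Rightarrow> bool"
  where "defect_space M F \<longleftrightarrow>
    near_invariance_space M F \<and> (\<forall>F'. near_invariance_space M F' \<longrightarrow> dim F \<le> dim F')"

definition nearly_invariant_with_defect :: "real hardy set \<Rightarrow> nat \<Rightarrow> bool"
  where "nearly_invariant_with_defect M n \<longleftrightarrow> (\<exists>F. defect_space M F \<and> dim F = n)"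

definition orthonormal_basis :: "('i \<Rightarrow> 'a::real_inner) \<Rightarrow> 'a set \<Rightarrow> bool"
  where "orthonormal_basis e F \<longleftrightarrow>
    (\<forall>i j. e i \<bullet> e j = (if i = j then 1 else 0)) \<and> span (range e) = F"

definition normalized_at_0 :: "real hardy set \<Rightarrow> real hardy \<Rightarrow> bool"
  where "normalized_at_0 M g \<longleftrightarrow>
    g \<in> M \<and> norm g = 1 \<and> (\<forall>f \<in> M \<inter> zH2. orthogonal g f) \<and> fps_nth (power_series g) 0 > 0"

end

theory Submission
  imports Defs
begin

text \<open>
  Let \<open>T\<close> be multiplication by \<open>z\<close>, let \<open>M\<^sub>0 = M \<inter> zH2\<close>, and let \<open>R = P\<^sub>M T\<^sup>* P\<^sub>M\<^sub>0\<close>, where \<open>P\<close> denotes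
  orthogonal projections. Near invariance says that for \<open>f \<in> M\<close>
  \<open>f = T (R f) + \<Sum> \<langle>f, c\<^sub>i\<rangle> \<theta>\<^sub>i\<close> and \<open>\<parallel>f\<parallel>\<^sup>2 = \<parallel>R f\<parallel>\<^sup>2 + \<Sum> \<langle>f, c\<^sub>i\<rangle>\<^sup>2\<close>,
  with \<open>\<theta>\<^sub>i = z e\<^sub>i\<close> and \<open>c\<^sub>i = P\<^sub>M\<^sub>0 (z e\<^sub>i)\<close>, to which the pair \<open>\<theta> = c = g\<close> is added if some
  function in \<open>M\<close> does not vanish at \<open>0\<close> (\<open>near_shift_expand\<close>, \<open>near_shift_energy\<close>,
  \<open>normalized_at_0_decomposition\<close>). Let \<open>h\<^sub>i\<close> be the power series with the coefficients
  \<open>\<langle>R\<^sup>k f, c\<^sub>i\<rangle>\<close>. Iterating the first identity gives \<open>f = \<Sum> \<theta>\<^sub>i h\<^sub>i\<close>, and passing from \<open>f\<close> to \<open>R f\<close> applies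
  the backward shift to all \<open>h\<^sub>i\<close>. So \<open>N\<close> can be taken as the set of all tuples \<open>(h\<^sub>i)\<close> that
  arise from \<open>f \<in> M\<close>, provided that \<open>\<parallel>f\<parallel>\<^sup>2 = \<Sum> \<parallel>h\<^sub>i\<parallel>\<^sup>2\<close>. Iterating the second identity, this
  means that \<open>R\<^sup>k f \<longlonglongrightarrow> 0\<close> for all \<open>f \<in> M\<close>.

  That is the crux (\<open>R_pow_tendsto_0\<close>). On \<open>M\<close>, the operator \<open>R\<close> differs from \<open>T\<^sup>*\<close> by one of finite rank,
  but a finite-rank perturbation can destroy the strong convergence of the powers to \<open>0\<close>.
  What saves the argument is that \<open>R\<close> is a contraction whose loss of energy is exactly what
  leaks out through the \<open>c\<^sub>i\<close>. This implies that sums \<open>\<Sum> u\<^sub>b R\<^sup>b\<^sup>+\<^sup>1 c\<^sub>i\<close> are bounded by the \<open>\<ell>\<^sup>2\<close> norm of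
  \<open>u\<close> (\<open>norm_reachable_le\<close>), which permits the comparison of \<open>R\<close> with \<open>T\<^sup>*\<close> by the wave
  operator method: the vectors \<open>T\<^sup>k R\<^sup>k R c\<^sub>i\<close> would have asymptotically stationary correlations, while a
  pure isometry forces these correlations to \<open>0\<close> (\<open>R_pow_channel_tendsto_0\<close>). The same
  applies to the powers of \<open>R\<close> (\<open>leaking_contraction_pow\<close>), which gives \<open>R\<^sup>k x \<longlonglongrightarrow> 0\<close> for all
  \<open>x = (R\<^sup>*)\<^sup>j c\<^sub>i\<close>. These vectors span a dense subspace of \<open>M\<close>, since a function with all \<open>h\<^sub>i = 0\<close> is \<open>0\<close>
  (\<open>unobservable_zero\<close>).
\<close>

section \<open>Projections in Hilbert spaces\<close>

text \<open>By the parallelogram law, a sequence in \<open>M\<close> whose distances to \<open>x\<close> tend to the infimum is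
  Cauchy; completeness gives its limit.\<close>

lemma nearest_point_exists:
  fixes M :: "'a::{real_inner, complete_space} set"
  assumes "subspace M" "closed M"
  shows "\<exists>p\<in>M. \<forall>m\<in>M. norm (x - p) \<le> norm (x - m)"
proof -
  define d where "d = (INF m\<in>M. (norm (x - m))\<^sup>2)"
  have ne: "M \<noteq> {}" using subspace_0[OF assms(1)] by auto
  have bdd: "bdd_below ((\<lambda>m. (norm (x - m))\<^sup>2) ` M)" by (rule bdd_belowI[of _ 0]) auto
  have d_le: "d \<le> (norm (x - m))\<^sup>2" if "m \<in> M" for m
    unfolding d_def using bdd that by (rule cINF_lower)
  have "\<exists>m\<in>M. (norm (x - m))\<^sup>2 < d + inverse (real (Suc k))" for k
  proof -
    have "d < d + inverse (real (Suc k))" by simp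
    then show ?thesis unfolding d_def using cINF_less_iff[OF ne bdd] by blast
  qed
  then obtain s where s: "\<And>k. s k \<in> M" "\<And>k. (norm (x - s k))\<^sup>2 < d + inverse (real (Suc k))"
    by metis
  have diff: "(norm (s j - s k))\<^sup>2 \<le> 2 * inverse (real (Suc j)) + 2 * inverse (real (Suc k))" for j k
  proof -
    define m where "m = (1/2) *\<^sub>R (s j + s k)"
    have "m \<in> M" unfolding m_def using assms(1) s(1) by (intro subspace_scale subspace_add)
    from d_le[OF this] have "d \<le> (norm (x - m))\<^sup>2" .
    moreover have "(norm (s j - s k))\<^sup>2
        = 2 * (norm (x - s j))\<^sup>2 + 2 * (norm (x - s k))\<^sup>2 - 4 * (norm (x - m))\<^sup>2"
      unfolding m_def power2_norm_eq_inner by (simp add: algebra_simps inner_commute)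
    ultimately show ?thesis using s(2)[of j] s(2)[of k] by linarith
  qed
  have "Cauchy s"
  proof (rule CauchyI)
    fix e :: real assume "0 < e"
    then obtain K where K: "inverse (real (Suc K)) < e\<^sup>2 / 4"
      using reals_Archimedean[of "e\<^sup>2 / 4"] by auto
    have "norm (s j - s k) < e" if "j \<ge> K" "k \<ge> K" for j k
    proof -
      have "inverse (real (Suc j)) \<le> inverse (real (Suc K))"
           "inverse (real (Suc k)) \<le> inverse (real (Suc K))" using that by simp_all
      then have "(norm (s j - s k))\<^sup>2 < e\<^sup>2" using diff[of j k] K by linarith
      then show ?thesis using \<open>0 < e\<close> by (metis less_imp_le power2_less_imp_less)
    qed
    then show "\<exists>K. \<forall>j\<ge>K. \<forall>k\<ge>K. norm (s j - s k) < e" by blast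
  qed
  then obtain p where p: "s \<longlonglongrightarrow> p" using Cauchy_convergent convergent_def by blast
  have pM: "p \<in> M" using assms(2) s(1) p by (rule closed_sequentially)
  have "(\<lambda>k. (norm (x - s k))\<^sup>2) \<longlonglongrightarrow> (norm (x - p))\<^sup>2"
    by (intro tendsto_intros p)
  moreover have "(\<lambda>k. d + inverse (real (Suc k))) \<longlonglongrightarrow> d + 0"
    by (intro tendsto_intros LIMSEQ_inverse_real_of_nat)
  ultimately have le_d: "(norm (x - p))\<^sup>2 \<le> d + 0"
    by (rule LIMSEQ_le) (use s(2) less_imp_le in blast)
  have "norm (x - p) \<le> norm (x - m)" if "m \<in> M" for m
  proof (rule power2_le_imp_le)
    show "(norm (x - p))\<^sup>2 \<le> (norm (x - m))\<^sup>2" using d_le[OF that] le_d by linarith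
  qed simp
  with pM show ?thesis by blast
qed

text \<open>At the nearest point \<open>p\<close>, moving by \<open>t m\<close> with \<open>m \<in> M\<close> cannot shorten \<open>x - p\<close>; the best choice
  of \<open>t\<close> would shorten it by a multiple of \<open>((x - p) \<bullet> m)\<^sup>2\<close>.\<close>

lemma orthogonal_decomposition_exists:
  fixes M :: "'a::{real_inner, complete_space} set"
  assumes M: "subspace M" "closed M"
  shows "\<exists>p\<in>M. \<forall>m\<in>M. (x - p) \<bullet> m = 0"
proof -
  obtain p where p: "p \<in> M" "\<And>m. m \<in> M \<Longrightarrow> norm (x - p) \<le> norm (x - m)"
    using nearest_point_exists[OF M] by blast
  have "(x - p) \<bullet> m = 0" if m: "m \<in> M" for m
  proof (cases "m = 0")
    case False
    define t where "t = ((x - p) \<bullet> m) / (m \<bullet> m)"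
    have mm: "m \<bullet> m > 0" using False by simp
    have "p + t *\<^sub>R m \<in> M" using M(1) p(1) m by (intro subspace_add subspace_scale)
    then have "norm (x - p) \<le> norm (x - (p + t *\<^sub>R m))" by (rule p(2))
    then have "(norm (x - p))\<^sup>2 \<le> (norm ((x - p) - t *\<^sub>R m))\<^sup>2"
      by (simp add: diff_diff_add)
    also have "\<dots> = (norm (x - p))\<^sup>2 - 2 * t * ((x - p) \<bullet> m) + t\<^sup>2 * (m \<bullet> m)"
      unfolding power2_norm_eq_inner by (simp add: algebra_simps inner_commute power2_eq_square)
    also have "\<dots> = (norm (x - p))\<^sup>2 - ((x - p) \<bullet> m)\<^sup>2 / (m \<bullet> m)"
      using mm unfolding t_def by (simp add: field_simps power2_eq_square)
    finally have "((x - p) \<bullet> m)\<^sup>2 / (m \<bullet> m) \<le> 0" by simp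
    then show ?thesis using mm by (simp add: divide_le_0_iff)
  qed simp
  with p(1) show ?thesis by blast
qed

definition projection :: "'a::real_inner set \<Rightarrow> 'a \<Rightarrow> 'a"
  where "projection M x = (SOME p. p \<in> M \<and> (\<forall>m\<in>M. (x - p) \<bullet> m = 0))"

context
  fixes M :: "'a::{real_inner, complete_space} set"
  assumes M: "subspace M" "closed M"
begin

lemma projection_in: "projection M x \<in> M"
  and projection_residual: "m \<in> M \<Longrightarrow> (x - projection M x) \<bullet> m = 0"
proof -
  have "projection M x \<in> M \<and> (\<forall>m\<in>M. (x - projection M x) \<bullet> m = 0)"
    unfolding projection_def
    by (rule someI_ex) (use orthogonal_decomposition_exists[OF M] in blast)
  then show "projection M x \<in> M" "m \<in> M \<Longrightarrow> (x - projection M x) \<bullet> m = 0" by blast+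
qed

lemma projection_unique:
  assumes "p \<in> M" "\<And>m. m \<in> M \<Longrightarrow> (x - p) \<bullet> m = 0"
  shows "projection M x = p"
proof -
  have d: "projection M x - p \<in> M" using M(1) projection_in assms(1) by (rule subspace_diff)
  have "(projection M x - p) \<bullet> (projection M x - p)
      = (x - p) \<bullet> (projection M x - p) - (x - projection M x) \<bullet> (projection M x - p)"
    by (simp add: algebra_simps)
  then show ?thesis using assms(2)[OF d] projection_residual[OF d] by simp
qed

lemma projection_ident: "x \<in> M \<Longrightarrow> projection M x = x"
  by (rule projection_unique) auto

lemma linear_projection: "linear (projection M)"
proof (rule linearI)
  fix x y :: 'a and r :: real
  show "projection M (x + y) = projection M x + projection M y"
  proof (rule projection_unique)
    show "projection M x + projection M y \<in> M" using M(1) projection_in by (intro subspace_add)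
    show "(x + y - (projection M x + projection M y)) \<bullet> m = 0" if "m \<in> M" for m
      using projection_residual[OF that, of x] projection_residual[OF that, of y]
      by (simp add: algebra_simps)
  qed
  show "projection M (r *\<^sub>R x) = r *\<^sub>R projection M x"
  proof (rule projection_unique)
    show "r *\<^sub>R projection M x \<in> M" using M(1) projection_in by (intro subspace_scale)
    show "(r *\<^sub>R x - r *\<^sub>R projection M x) \<bullet> m = 0" if "m \<in> M" for m
      using projection_residual[OF that, of x] by (simp flip: scaleR_diff_right)
  qed
qed

lemma projection_inner_eq: "m \<in> M \<Longrightarrow> projection M x \<bullet> m = x \<bullet> m"
  using projection_residual[of m x] by (simp add: inner_diff_left)

lemma projection_self_adjoint: "projection M x \<bullet> y = x \<bullet> projection M y"
  using projection_inner_eq[OF projection_in, of y x] projection_inner_eq[OF projection_in, of x y]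
  by (metis inner_commute)

end

lemma closed_isometric_image:
  fixes J :: "'a::{real_inner, complete_space} \<Rightarrow> 'b::real_normed_vector"
  assumes M: "subspace M" "closed M" and J: "linear J"
    and iso: "\<And>f. f \<in> M \<Longrightarrow> norm (J f) = norm f"
  shows "closed (J ` M)"
  unfolding closed_sequential_limits
proof (intro allI impI)
  fix y l assume yl: "(\<forall>n. y n \<in> J ` M) \<and> y \<longlonglongrightarrow> l"
  then have l: "y \<longlonglongrightarrow> l" by blast
  have "\<forall>n. \<exists>f. f \<in> M \<and> y n = J f" using yl by blast
  then obtain f where f: "\<And>n. f n \<in> M" "\<And>n. y n = J (f n)" by metis
  have dist_eq: "norm (J a - J b) = norm (a - b)" if "a \<in> M" "b \<in> M" for a b
    using iso[OF subspace_diff[OF M(1) that]] by (simp add: linear_diff[OF J])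
  have "Cauchy y" using l by (rule LIMSEQ_imp_Cauchy)
  then have "Cauchy f" unfolding Cauchy_def dist_norm f(2) dist_eq[OF f(1) f(1)] .
  then obtain p where p: "f \<longlonglongrightarrow> p" using Cauchy_convergent convergent_def by blast
  have pM: "p \<in> M" using M(2) f(1) p by (rule closed_sequentially)
  have "(\<lambda>n. norm (f n - p)) \<longlonglongrightarrow> 0" using p by (simp add: LIM_zero_iff tendsto_norm_zero)
  then have "(\<lambda>n. norm (y n - J p)) \<longlonglongrightarrow> 0" by (simp add: f dist_eq pM)
  then have "y \<longlonglongrightarrow> J p" by (simp add: LIM_zero_iff tendsto_norm_zero_iff)
  then show "l \<in> J ` M" using l pM LIMSEQ_unique by blast
qed

section \<open>Contractions that leak into finitely many channels\<close>

lemma linear_funpow: "linear (f :: 'a::real_vector \<Rightarrow> 'a) \<Longrightarrow> linear (f ^^ k)"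
  by (induction k) (auto intro: linear_compose linear_id)

text \<open>The abstract situation. At each step \<open>f \<in> M\<close> is split into \<open>T (R f)\<close> and a combination of the
  fixed vectors \<open>\<theta>\<^sub>i\<close>; the coefficients \<open>f \<bullet> c\<^sub>i\<close> are what leaks out through the channels, and they
  account exactly for the energy that \<open>R\<close> loses. Assumption \<open>pure\<close> says that the adjoint of the
  isometry \<open>T\<close> has powers tending strongly to \<open>0\<close>, in a form that mentions no adjoint and passes
  to powers of \<open>T\<close>.\<close>

locale leaking_contraction =
  fixes M :: "'a::real_inner set" and R T :: "'a \<Rightarrow> 'a"
    and I :: "'i set" and c \<theta> :: "'i \<Rightarrow> 'a"
  assumes subspace_M: "subspace M"
    and finite_I: "finite I"
    and linear_R: "linear R" and R_in: "\<And>x. R x \<in> M"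
    and linear_T: "linear T" and norm_T: "\<And>x. norm (T x) = norm x"
    and c_in: "\<And>i. i \<in> I \<Longrightarrow> c i \<in> M"
    and expand: "\<And>f. f \<in> M \<Longrightarrow> f = T (R f) + (\<Sum>i\<in>I. (f \<bullet> c i) *\<^sub>R \<theta> i)"
    and energy: "\<And>f. f \<in> M \<Longrightarrow> (norm f)\<^sup>2 = (norm (R f))\<^sup>2 + (\<Sum>i\<in>I. (f \<bullet> c i)\<^sup>2)"
    and pure: "\<And>y. \<exists>\<epsilon>. \<epsilon> \<longlonglongrightarrow> 0 \<and> (\<forall>l x. \<bar>y \<bullet> (T ^^ l) x\<bar> \<le> \<epsilon> l * norm x)"
begin

lemma R_pow_in: "f \<in> M \<Longrightarrow> (R ^^ k) f \<in> M"
  by (cases k) (auto simp: R_in)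

lemma norm_T_pow: "norm ((T ^^ k) x) = norm x"
  by (induction k) (auto simp: norm_T)

lemma inner_T_pow: "(T ^^ k) x \<bullet> (T ^^ k) y = x \<bullet> y"
proof -
  have sq: "(T ^^ k) v \<bullet> (T ^^ k) v = v \<bullet> v" for v
    using norm_T_pow[of k v] by (simp add: norm_eq_sqrt_inner)
  show ?thesis
    using sq[of "x + y"] sq[of x] sq[of y]
    by (simp add: linear_add[OF linear_funpow[OF linear_T]]
      inner_add_left inner_add_right inner_commute)
qed

lemma energy_pow:
  assumes "f \<in> M"
  shows "(norm f)\<^sup>2 = (norm ((R ^^ K) f))\<^sup>2 + (\<Sum>k<K. \<Sum>i\<in>I. ((R ^^ k) f \<bullet> c i)\<^sup>2)"
  by (induction K) (use energy[OF R_pow_in[OF assms]] in auto)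

lemma expand_pow:
  assumes "f \<in> M"
  shows "f = (T ^^ K) ((R ^^ K) f) + (\<Sum>k<K. (T ^^ k) (\<Sum>i\<in>I. ((R ^^ k) f \<bullet> c i) *\<^sub>R \<theta> i))"
proof (induction K)
  case (Suc K)
  have "(T ^^ K) ((R ^^ K) f) = (T ^^ K) (T ((R ^^ Suc K) f) + (\<Sum>i\<in>I. ((R ^^ K) f \<bullet> c i) *\<^sub>R \<theta> i))"
    using expand[OF R_pow_in[OF assms, of K]] by simp
  also have "\<dots> = (T ^^ Suc K) ((R ^^ Suc K) f) + (T ^^ K) (\<Sum>i\<in>I. ((R ^^ K) f \<bullet> c i) *\<^sub>R \<theta> i)"
    by (simp add: linear_add[OF linear_funpow[OF linear_T]] funpow_swap1)
  finally show ?case using Suc by (simp add: add_ac)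
qed simp

lemma norm_R_pow_le:
  assumes "f \<in> M"
  shows "norm ((R ^^ k) f) \<le> norm f"
proof (rule power2_le_imp_le)
  have "0 \<le> (\<Sum>j<k. \<Sum>i\<in>I. ((R ^^ j) f \<bullet> c i)\<^sup>2)" by (intro sum_nonneg) auto
  then show "(norm ((R ^^ k) f))\<^sup>2 \<le> (norm f)\<^sup>2" using energy_pow[OF assms, of k] by linarith
qed simp

lemma norm_R_pow_decreasing: "f \<in> M \<Longrightarrow> norm ((R ^^ (k + j)) f) \<le> norm ((R ^^ k) f)"
  using norm_R_pow_le[OF R_pow_in, of f j k] by (simp add: funpow_add add.commute[of k])

text \<open>If nothing ever leaks out of \<open>f\<close>, then \<open>f = T\<^sup>k R\<^sup>k f\<close> for all \<open>k\<close>, and \<open>T\<close> is pure.\<close>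

lemma unobservable_zero:
  assumes f: "f \<in> M" and 0: "\<And>k i. i \<in> I \<Longrightarrow> (R ^^ k) f \<bullet> c i = 0"
  shows "f = 0"
proof -
  obtain \<epsilon> where \<epsilon>: "\<epsilon> \<longlonglongrightarrow> 0" "\<And>l x. \<bar>f \<bullet> (T ^^ l) x\<bar> \<le> \<epsilon> l * norm x"
    using pure[of f] by blast
  have T0: "(T ^^ k) 0 = 0" for k by (rule linear_0[OF linear_funpow[OF linear_T]])
  have "f \<bullet> f \<le> \<epsilon> k * norm f" for k
  proof -
    have eq: "f = (T ^^ k) ((R ^^ k) f)" using expand_pow[OF f, of k] by (simp add: 0 T0)
    then have "norm ((R ^^ k) f) = norm f" by (metis norm_T_pow)
    with \<epsilon>(2)[of k "(R ^^ k) f"] eq show ?thesis by simp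
  qed
  then have "f \<bullet> f \<le> 0 * norm f"
    by (intro LIMSEQ_le_const[OF tendsto_mult_right[OF \<epsilon>(1)]]) auto
  then show ?thesis using inner_ge_zero[of f] inner_eq_zero_iff[of f] by linarith
qed

lemma summable_output:
  assumes "f \<in> M" "i \<in> I"
  shows "summable (\<lambda>k. ((R ^^ k) f \<bullet> c i)\<^sup>2)"
proof (rule summableI_nonneg_bounded[where x = "(norm f)\<^sup>2"])
  fix K
  have "(\<Sum>k<K. ((R ^^ k) f \<bullet> c i)\<^sup>2) \<le> (\<Sum>k<K. \<Sum>i\<in>I. ((R ^^ k) f \<bullet> c i)\<^sup>2)"
    using assms(2) finite_I by (intro sum_mono member_le_sum) auto
  also have "\<dots> \<le> (norm f)\<^sup>2" using energy_pow[OF assms(1), of K] by simp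
  finally show "(\<Sum>k<K. ((R ^^ k) f \<bullet> c i)\<^sup>2) \<le> (norm f)\<^sup>2" .
qed simp

text \<open>With \<open>x = u c\<^sub>i + y\<close>, the energy balance gives \<open>\<parallel>R x\<parallel>\<^sup>2 \<le> \<parallel>x\<parallel>\<^sup>2 - (x \<bullet> c\<^sub>i)\<^sup>2\<close>, and
  \<open>\<parallel>x\<parallel>\<^sup>2 = \<parallel>y\<parallel>\<^sup>2 + 2 u (x \<bullet> c\<^sub>i) - u\<^sup>2 \<parallel>c\<^sub>i\<parallel>\<^sup>2\<close>; the loss through channel \<open>i\<close> absorbs the cross term.\<close>

lemma norm_R_input_le:
  assumes y: "y \<in> M" and i: "i \<in> I"
  shows "(norm (R (u *\<^sub>R c i + y)))\<^sup>2 \<le> u\<^sup>2 + (norm y)\<^sup>2"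
proof -
  let ?x = "u *\<^sub>R c i + y"
  have x: "?x \<in> M" using subspace_M y c_in[OF i] by (intro subspace_add subspace_scale)
  have "(?x \<bullet> c i)\<^sup>2 \<le> (\<Sum>j\<in>I. (?x \<bullet> c j)\<^sup>2)"
    using finite_I i by (intro member_le_sum) auto
  then have "(norm (R ?x))\<^sup>2 \<le> (norm ?x)\<^sup>2 - (?x \<bullet> c i)\<^sup>2" using energy[OF x] by simp
  moreover have "(norm ?x)\<^sup>2 = (norm y)\<^sup>2 + 2 * u * (?x \<bullet> c i) - (u * norm (c i))\<^sup>2"
    unfolding power_mult_distrib power2_norm_eq_inner
    by (simp add: inner_add_left inner_add_right inner_commute power2_eq_square algebra_simps)
  moreover have "2 * u * (?x \<bullet> c i) \<le> u\<^sup>2 + (?x \<bullet> c i)\<^sup>2" by (rule sum_squares_bound)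
  ultimately show ?thesis using zero_le_power2[of "u * norm (c i)"] by linarith
qed

text \<open>The previous lemma iterated by Horner's scheme. The point is that the bound does not depend on
  \<open>B\<close>: the orbit of \<open>R c\<^sub>i\<close> behaves like an orthonormal sequence as far as upper bounds are
  concerned.\<close>

lemma norm_reachable_le:
  assumes i: "i \<in> I"
  shows "(norm (\<Sum>b<B. u b *\<^sub>R (R ^^ Suc b) (c i)))\<^sup>2 \<le> (\<Sum>b<B. (u b)\<^sup>2)"
proof (induction B arbitrary: u)
  case (Suc B)
  let ?y = "\<Sum>b<B. u (Suc b) *\<^sub>R (R ^^ Suc b) (c i)"
  have "?y \<in> M" using subspace_M by (intro subspace_sum subspace_scale R_pow_in c_in i)
  have "(\<Sum>b<Suc B. u b *\<^sub>R (R ^^ Suc b) (c i)) = R (u 0 *\<^sub>R c i + ?y)"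
    by (subst sum.lessThan_Suc_shift)
       (simp add: linear_add[OF linear_R] linear_sum[OF linear_R] linear_scale[OF linear_R])
  also have "(norm \<dots>)\<^sup>2 \<le> (u 0)\<^sup>2 + (norm ?y)\<^sup>2" by (rule norm_R_input_le[OF \<open>?y \<in> M\<close> i])
  also have "\<dots> \<le> (u 0)\<^sup>2 + (\<Sum>b<B. (u (Suc b))\<^sup>2)" using Suc[of "\<lambda>b. u (Suc b)"] by simp
  also have "\<dots> = (\<Sum>b<Suc B. (u b)\<^sup>2)" by (simp add: sum.lessThan_Suc_shift del: sum.lessThan_Suc)
  finally show ?case .
qed simp

text \<open>Each summand pairs a point of the orbit of \<open>\<phi>\<close> with a leaked quantity. Collecting, for each
  channel, the leaked coefficients on the side of the orbit turns the sum into the vectors bounded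
  by \<open>norm_reachable_le\<close>, so that only the square-summable tail of the coefficients remains, uniformly in \<open>B\<close>.\<close>

lemma sum_interaction_le:
  assumes j: "j \<in> I" and \<phi>: "\<phi> = R (c j)"
    and G: "linear G" "\<And>x. x \<in> M \<Longrightarrow> norm (G x) \<le> norm x"
  shows "\<bar>\<Sum>b<B. G ((R ^^ b) \<phi>) \<bullet> (T ^^ l) (\<Sum>i\<in>I. ((R ^^ (m + b)) \<phi> \<bullet> c i) *\<^sub>R \<theta> i)\<bar>
    \<le> (\<Sum>i\<in>I. sqrt (\<Sum>b. ((R ^^ (b + m)) \<phi> \<bullet> c i)\<^sup>2) * norm (\<theta> i))"
proof -
  have \<phi>M: "\<phi> \<in> M" by (simp add: \<phi> R_in)
  let ?u = "\<lambda>i b. (R ^^ (m + b)) \<phi> \<bullet> c i"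
  let ?s = "\<lambda>i. \<Sum>b<B. ?u i b *\<^sub>R (R ^^ b) \<phi>"
  have linT: "linear (T ^^ l)" by (rule linear_funpow[OF linear_T])
  have "(\<Sum>b<B. G ((R ^^ b) \<phi>) \<bullet> (T ^^ l) (\<Sum>i\<in>I. ?u i b *\<^sub>R \<theta> i))
      = (\<Sum>b<B. \<Sum>i\<in>I. ?u i b * (G ((R ^^ b) \<phi>) \<bullet> (T ^^ l) (\<theta> i)))"
    by (simp add: linear_sum[OF linT] linear_scale[OF linT] inner_sum_right)
  also have "\<dots> = (\<Sum>i\<in>I. G (?s i) \<bullet> (T ^^ l) (\<theta> i))"
    by (subst sum.swap) (simp add: linear_sum[OF G(1)] linear_scale[OF G(1)] inner_sum_left)
  finally have "\<bar>\<Sum>b<B. G ((R ^^ b) \<phi>) \<bullet> (T ^^ l) (\<Sum>i\<in>I. ?u i b *\<^sub>R \<theta> i)\<bar>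
      \<le> (\<Sum>i\<in>I. \<bar>G (?s i) \<bullet> (T ^^ l) (\<theta> i)\<bar>)" by simp
  also have "\<dots> \<le> (\<Sum>i\<in>I. sqrt (\<Sum>b. ((R ^^ (b + m)) \<phi> \<bullet> c i)\<^sup>2) * norm (\<theta> i))"
  proof (rule sum_mono)
    fix i assume i: "i \<in> I"
    have sm: "summable (\<lambda>b. (?u i b)\<^sup>2)"
      using summable_ignore_initial_segment[OF summable_output[OF \<phi>M i], of m]
      by (simp add: add.commute)
    have "(norm (?s i))\<^sup>2 \<le> (\<Sum>b<B. (?u i b)\<^sup>2)"
      using norm_reachable_le[OF j, of "?u i" B] by (simp add: \<phi> funpow_swap1)
    also have "\<dots> \<le> (\<Sum>b. (?u i b)\<^sup>2)" using sm by (intro sum_le_suminf) auto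
    finally have s: "norm (?s i) \<le> sqrt (\<Sum>b. ((R ^^ (b + m)) \<phi> \<bullet> c i)\<^sup>2)"
      by (simp add: real_le_rsqrt add.commute)
    have "?s i \<in> M" using subspace_M by (intro subspace_sum subspace_scale R_pow_in \<phi>M)
    from G(2)[OF this] s have "norm (G (?s i)) \<le> sqrt (\<Sum>b. ((R ^^ (b + m)) \<phi> \<bullet> c i)\<^sup>2)"
      by simp
    then show "\<bar>G (?s i) \<bullet> (T ^^ l) (\<theta> i)\<bar>
        \<le> sqrt (\<Sum>b. ((R ^^ (b + m)) \<phi> \<bullet> c i)\<^sup>2) * norm (\<theta> i)"
      using Cauchy_Schwarz_ineq2[of "G (?s i)" "(T ^^ l) (\<theta> i)"]
      by (simp add: norm_T_pow) (meson mult_right_mono norm_ge_zero order_trans)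
  qed
  finally show ?thesis .
qed

text \<open>The heart of the proof, a discrete form of Pearson's argument from scattering theory. Put
  \<open>\<phi> = R c\<^sub>j\<close> and \<open>w\<^sub>k = T\<^sup>k R\<^sup>k \<phi>\<close>; the norms \<open>\<parallel>w\<^sub>k\<parallel> = \<parallel>R\<^sup>k \<phi>\<parallel>\<close> decrease to some \<open>\<delta>\<close>. The correlation
  \<open>w\<^sub>k \<bullet> w\<^sub>l\<close> changes under a common shift of both indices by at most \<open>\<eta>\<^sub>k + \<eta>\<^sub>l\<close>, however large the shift,
  where \<open>\<eta>\<close> is a tail and tends to \<open>0\<close>. Shifting to infinity, where \<open>w\<close> varies slowly,
  the correlation tends to \<open>\<delta>\<^sup>2\<close>. On the other hand it tends to \<open>0\<close> when \<open>k\<close> is kept and \<open>l\<close> grows,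
  because \<open>T\<close> is pure. Hence \<open>\<delta>\<^sup>2 \<le> \<eta>\<^sub>k\<close> for every \<open>k\<close>.\<close>

lemma R_pow_channel_tendsto_0:
  assumes j: "j \<in> I"
  shows "(\<lambda>k. (R ^^ k) (c j)) \<longlonglongrightarrow> 0"
proof -
  define \<phi> where "\<phi> = R (c j)"
  define w where "w k = (T ^^ k) ((R ^^ k) \<phi>)" for k
  define d where "d k = (T ^^ k) (\<Sum>i\<in>I. ((R ^^ k) \<phi> \<bullet> c i) *\<^sub>R \<theta> i)" for k
  define \<eta> where "\<eta> m = (\<Sum>i\<in>I. sqrt (\<Sum>b. ((R ^^ (b + m)) \<phi> \<bullet> c i)\<^sup>2) * norm (\<theta> i))" for m
  have \<phi>M: "\<phi> \<in> M" by (simp add: \<phi>_def R_in)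
  have linT: "linear (T ^^ k)" and linR: "linear (R ^^ k)" for k
    by (intro linear_funpow linear_T linear_R)+
  have step: "w k = w (Suc k) + d k" for k
  proof -
    have "w k = (T ^^ k) (T (R ((R ^^ k) \<phi>)) + (\<Sum>i\<in>I. ((R ^^ k) \<phi> \<bullet> c i) *\<^sub>R \<theta> i))"
      unfolding w_def using expand[OF R_pow_in[OF \<phi>M, of k]] by simp
    then show ?thesis by (simp add: w_def d_def linear_add[OF linT] funpow_swap1)
  qed
  have norm_w: "norm (w k) = norm ((R ^^ k) \<phi>)" for k by (simp add: w_def norm_T_pow)
  have \<eta>0: "\<eta> \<longlonglongrightarrow> 0"
  proof -
    have "(\<lambda>m. \<Sum>b. ((R ^^ (b + m)) \<phi> \<bullet> c i)\<^sup>2) \<longlonglongrightarrow> 0" if "i \<in> I" for i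
      using suminf_exist_split2[OF summable_output[OF \<phi>M that]] .
    then have "(\<lambda>m. \<Sum>i\<in>I. sqrt (\<Sum>b. ((R ^^ (b + m)) \<phi> \<bullet> c i)\<^sup>2) * norm (\<theta> i))
        \<longlonglongrightarrow> (\<Sum>i\<in>I. sqrt 0 * norm (\<theta> i))"
      by (intro tendsto_sum tendsto_mult tendsto_const tendsto_real_sqrt) auto
    then show ?thesis by (simp add: \<eta>_def[abs_def])
  qed
  have d0: "d \<longlonglongrightarrow> 0"
  proof -
    have "(\<lambda>k. (R ^^ k) \<phi> \<bullet> c i) \<longlonglongrightarrow> 0" if "i \<in> I" for i
      using tendsto_real_sqrt[OF summable_LIMSEQ_zero[OF summable_output[OF \<phi>M that]]]
      by (simp add: tendsto_rabs_zero_iff)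
    then have "(\<lambda>k. \<Sum>i\<in>I. ((R ^^ k) \<phi> \<bullet> c i) *\<^sub>R \<theta> i) \<longlonglongrightarrow> (\<Sum>i\<in>I. 0 *\<^sub>R \<theta> i)"
      by (intro tendsto_sum tendsto_scaleR tendsto_const) auto
    then have "(\<lambda>k. norm (d k)) \<longlonglongrightarrow> 0"
      by (simp add: d_def norm_T_pow tendsto_norm_zero_iff)
    then show ?thesis by (rule tendsto_norm_zero_cancel)
  qed
  \<comment> \<open>Telescoping over the shift works because \<open>w (k + b)\<close> and \<open>d (m + b)\<close> share the factor \<open>T\<^sup>b\<close>,
    which inner products do not see.\<close>
  have shift_bound: "\<bar>w k \<bullet> w l - w (k + B) \<bullet> w (l + B)\<bar> \<le> \<eta> l + \<eta> k" for k l B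
  proof -
    have "w k \<bullet> w l - w (k + B) \<bullet> w (l + B)
        = (\<Sum>b<B. w (k + b) \<bullet> w (l + b) - w (k + Suc b) \<bullet> w (l + Suc b))"
      by (subst sum_lessThan_telescope') simp
    also have "\<dots> = (\<Sum>b<B. w (k + b) \<bullet> d (l + b)) + (\<Sum>b<B. w (Suc l + b) \<bullet> d (k + b))"
      unfolding sum.distrib[symmetric]
    proof (rule sum.cong[OF refl])
      fix b
      show "w (k + b) \<bullet> w (l + b) - w (k + Suc b) \<bullet> w (l + Suc b)
          = w (k + b) \<bullet> d (l + b) + w (Suc l + b) \<bullet> d (k + b)"
        using step[of "k + b"] step[of "l + b"] by (simp add: inner_add_left inner_add_right inner_commute)
    qed
    finally have eq: "w k \<bullet> w l - w (k + B) \<bullet> w (l + B)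
        = (\<Sum>b<B. w (k + b) \<bullet> d (l + b)) + (\<Sum>b<B. w (Suc l + b) \<bullet> d (k + b))" .
    have part: "\<bar>\<Sum>b<B. w (k + b) \<bullet> d (m + b)\<bar> \<le> \<eta> m" for k m
    proof -
      have "w (k + b) \<bullet> d (m + b) = ((T ^^ k) \<circ> (R ^^ k)) ((R ^^ b) \<phi>)
          \<bullet> (T ^^ m) (\<Sum>i\<in>I. ((R ^^ (m + b)) \<phi> \<bullet> c i) *\<^sub>R \<theta> i)" for b
      proof -
        have "w (k + b) = (T ^^ b) ((T ^^ k) ((R ^^ k) ((R ^^ b) \<phi>)))"
          by (simp add: w_def funpow_add[of b k, symmetric, THEN fun_cong, unfolded comp_def]
            funpow_add[of k b, symmetric, THEN fun_cong, unfolded comp_def] add.commute)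
        moreover have "d (m + b) = (T ^^ b) ((T ^^ m) (\<Sum>i\<in>I. ((R ^^ (m + b)) \<phi> \<bullet> c i) *\<^sub>R \<theta> i))"
          by (simp add: d_def funpow_add[of b m, symmetric, THEN fun_cong, unfolded comp_def] add.commute)
        ultimately show ?thesis by (simp add: inner_T_pow)
      qed
      then show ?thesis unfolding \<eta>_def
        using sum_interaction_le[OF j \<phi>_def, where G = "(T ^^ k) \<circ> (R ^^ k)" and B = B and l = m and m = m]
        by (simp add: linear_compose linT linR norm_T_pow norm_R_pow_le)
    qed
    show ?thesis unfolding eq using part[of k l] part[of "Suc l" k] by linarith
  qed
  have "decseq (\<lambda>k. norm ((R ^^ k) \<phi>))"
    unfolding decseq_Suc_iff using norm_R_pow_decreasing[OF \<phi>M, of _ 1] by simp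
  then obtain \<delta> where \<delta>: "(\<lambda>k. norm ((R ^^ k) \<phi>)) \<longlonglongrightarrow> \<delta>"
    using decseq_convergent[of "\<lambda>k. norm ((R ^^ k) \<phi>)" 0] by auto
  have far: "(\<lambda>B. w (k + B) - w (k + p + B)) \<longlonglongrightarrow> 0" for k p
  proof (induction p)
    case (Suc p)
    have "(\<lambda>B. d (B + (k + p))) \<longlonglongrightarrow> 0" using d0 by (rule LIMSEQ_ignore_initial_segment)
    from tendsto_add[OF Suc this]
    have "(\<lambda>B. w (k + B) - w (k + p + B) + d (B + (k + p))) \<longlonglongrightarrow> 0" by simp
    moreover have "w (k + B) - w (k + p + B) + d (B + (k + p)) = w (k + B) - w (k + Suc p + B)" for B
      using step[of "k + p + B"] by (simp add: algebra_simps)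
    ultimately show ?case by simp
  qed simp
  have near: "\<bar>w k \<bullet> w (k + p) - \<delta>\<^sup>2\<bar> \<le> \<eta> (k + p) + \<eta> k" for k p
  proof -
    have n1: "(\<lambda>B. (norm (w (k + B)))\<^sup>2) \<longlonglongrightarrow> \<delta>\<^sup>2" for k
      unfolding norm_w using LIMSEQ_ignore_initial_segment[OF \<delta>, of k]
      by (intro tendsto_power) (simp add: add.commute)
    have eq: "w (k + B) \<bullet> w (k + p + B) = ((norm (w (k + B)))\<^sup>2 + (norm (w (k + p + B)))\<^sup>2
        - (norm (w (k + B) - w (k + p + B)))\<^sup>2) / 2" for B
      unfolding power2_norm_eq_inner by (simp add: algebra_simps inner_commute)
    have "(\<lambda>B. ((norm (w (k + B)))\<^sup>2 + (norm (w (k + p + B)))\<^sup>2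
        - (norm (w (k + B) - w (k + p + B)))\<^sup>2) / 2) \<longlonglongrightarrow> (\<delta>\<^sup>2 + \<delta>\<^sup>2 - (norm (0::'a))\<^sup>2) / 2"
      by (intro tendsto_intros n1 far) simp
    then have "(\<lambda>B. w (k + B) \<bullet> w (k + p + B)) \<longlonglongrightarrow> \<delta>\<^sup>2"
      unfolding eq[symmetric] by simp
    then have "(\<lambda>B. \<bar>w k \<bullet> w (k + p) - w (k + B) \<bullet> w (k + p + B)\<bar>) \<longlonglongrightarrow> \<bar>w k \<bullet> w (k + p) - \<delta>\<^sup>2\<bar>"
      by (intro tendsto_intros)
    then show ?thesis by (rule LIMSEQ_le_const2) (use shift_bound in blast)
  qed
  have "\<delta>\<^sup>2 \<le> \<eta> k" for k
  proof -
    obtain \<epsilon> where \<epsilon>: "\<epsilon> \<longlonglongrightarrow> 0" "\<And>l x. \<bar>w k \<bullet> (T ^^ l) x\<bar> \<le> \<epsilon> l * norm x"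
      using pure[of "w k"] by blast
    have "\<delta>\<^sup>2 \<le> \<bar>\<epsilon> (p + k)\<bar> * norm \<phi> + \<eta> (p + k) + \<eta> k" for p
    proof -
      have "\<bar>w k \<bullet> w (k + p)\<bar> \<le> \<epsilon> (k + p) * norm ((R ^^ (k + p)) \<phi>)" unfolding w_def[of "k + p"] by (rule \<epsilon>(2))
      also have "\<dots> \<le> \<bar>\<epsilon> (k + p)\<bar> * norm \<phi>" by (intro mult_mono norm_R_pow_le \<phi>M) auto
      finally show ?thesis using near[of k p] by (simp add: add.commute)
    qed
    moreover have "(\<lambda>p. \<bar>\<epsilon> (p + k)\<bar> * norm \<phi> + \<eta> (p + k) + \<eta> k) \<longlonglongrightarrow> \<bar>0\<bar> * norm \<phi> + 0 + \<eta> k"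
      by (intro tendsto_intros LIMSEQ_ignore_initial_segment \<epsilon>(1) \<eta>0)
    ultimately have "\<delta>\<^sup>2 \<le> \<bar>0\<bar> * norm \<phi> + 0 + \<eta> k" by (intro LIMSEQ_le_const) auto
    then show ?thesis by simp
  qed
  then have "\<delta>\<^sup>2 \<le> 0" by (intro LIMSEQ_le_const[OF \<eta>0]) auto
  then have "\<delta> = 0" by simp
  with \<delta> have "(\<lambda>k. (R ^^ k) \<phi>) \<longlonglongrightarrow> 0" by (simp add: tendsto_norm_zero_iff)
  then have "(\<lambda>k. (R ^^ Suc k) (c j)) \<longlonglongrightarrow> 0" by (simp add: \<phi>_def funpow_swap1)
  then show ?thesis by (rule LIMSEQ_imp_Suc)
qed

end

lemma strict_mono_mult_Suc: "strict_mono (\<lambda>k. Suc j * k)"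
  by (rule strict_monoI, rule mult_less_mono2) auto

text \<open>The adjoint of \<open>R\<close> supplies the vectors \<open>R'\<^sup>m c\<^sub>i\<close> that represent the outputs \<open>f \<mapsto> R\<^sup>m f \<bullet> c\<^sub>i\<close>.\<close>

locale leaking_contraction_adjoint = leaking_contraction M R T I c \<theta>
  for M :: "'a::{real_inner, complete_space} set" and R T :: "'a \<Rightarrow> 'a"
    and I :: "'i set" and c \<theta> :: "'i \<Rightarrow> 'a" +
  fixes R' :: "'a \<Rightarrow> 'a"
  assumes closed_M: "closed M"
    and adjoint: "\<And>x y. R x \<bullet> y = x \<bullet> R' y"
    and R'_in: "\<And>y. R' y \<in> M"
begin

lemma adjoint_pow: "(R ^^ k) x \<bullet> y = x \<bullet> (R' ^^ k) y"
  by (induction k arbitrary: x y) (auto simp: adjoint funpow_swap1)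

lemma R'_pow_in: "y \<in> M \<Longrightarrow> (R' ^^ k) y \<in> M"
  by (cases k) (auto simp: R'_in)

text \<open>Doing \<open>j + 1\<close> steps at once is a situation of the same kind; what leaks at the intermediate times
  \<open>m \<le> j\<close> counts as further channels, whose vectors are \<open>R'\<^sup>m c\<^sub>i\<close>. This brings the vectors
  \<open>R'\<^sup>j c\<^sub>i\<close> within reach of \<open>R_pow_channel_tendsto_0\<close>, which by itself treats only the \<open>c\<^sub>i\<close>.\<close>

lemma leaking_contraction_pow:
  "leaking_contraction M (R ^^ Suc j) (T ^^ Suc j) (I \<times> {..<Suc j})
     (\<lambda>(i, m). (R' ^^ m) (c i)) (\<lambda>(i, m). (T ^^ m) (\<theta> i))"
proof (rule leaking_contraction.intro)
  show "subspace M" by (rule subspace_M)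
  show "finite (I \<times> {..<Suc j})" using finite_I by simp
  show "linear (R ^^ Suc j)" "linear (T ^^ Suc j)" by (intro linear_funpow linear_R linear_T)+
  show "(R ^^ Suc j) x \<in> M" for x by (simp add: R_in)
  show "norm ((T ^^ Suc j) x) = norm x" for x by (rule norm_T_pow)
  show "(case p of (i, m) \<Rightarrow> (R' ^^ m) (c i)) \<in> M" if "p \<in> I \<times> {..<Suc j}" for p
    using that by (auto intro!: R'_pow_in c_in)
  fix f assume f: "f \<in> M"
  have "(\<Sum>p\<in>I \<times> {..<Suc j}. (f \<bullet> (case p of (i, m) \<Rightarrow> (R' ^^ m) (c i)))
          *\<^sub>R (case p of (i, m) \<Rightarrow> (T ^^ m) (\<theta> i)))
      = (\<Sum>(i, m)\<in>I \<times> {..<Suc j}. ((R ^^ m) f \<bullet> c i) *\<^sub>R (T ^^ m) (\<theta> i))"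
    by (intro sum.cong refl) (auto simp: adjoint_pow split del: if_split)
  also have "\<dots> = (\<Sum>i\<in>I. \<Sum>m<Suc j. ((R ^^ m) f \<bullet> c i) *\<^sub>R (T ^^ m) (\<theta> i))"
    by (rule sum.cartesian_product[symmetric])
  also have "\<dots> = (\<Sum>m<Suc j. \<Sum>i\<in>I. ((R ^^ m) f \<bullet> c i) *\<^sub>R (T ^^ m) (\<theta> i))"
    by (rule sum.swap)
  also have "\<dots> = (\<Sum>m<Suc j. (T ^^ m) (\<Sum>i\<in>I. ((R ^^ m) f \<bullet> c i) *\<^sub>R \<theta> i))"
    by (intro sum.cong refl)
       (simp add: linear_sum[OF linear_funpow[OF linear_T]] linear_scale[OF linear_funpow[OF linear_T]])
  finally show "f = (T ^^ Suc j) ((R ^^ Suc j) f)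
      + (\<Sum>p\<in>I \<times> {..<Suc j}. (f \<bullet> (case p of (i, m) \<Rightarrow> (R' ^^ m) (c i)))
          *\<^sub>R (case p of (i, m) \<Rightarrow> (T ^^ m) (\<theta> i)))"
    using expand_pow[OF f, of "Suc j"] by argo
  have "(\<Sum>p\<in>I \<times> {..<Suc j}. (f \<bullet> (case p of (i, m) \<Rightarrow> (R' ^^ m) (c i)))\<^sup>2)
      = (\<Sum>(i, m)\<in>I \<times> {..<Suc j}. ((R ^^ m) f \<bullet> c i)\<^sup>2)"
    by (intro sum.cong refl) (auto simp: adjoint_pow)
  also have "\<dots> = (\<Sum>i\<in>I. \<Sum>m<Suc j. ((R ^^ m) f \<bullet> c i)\<^sup>2)"
    by (rule sum.cartesian_product[symmetric])
  also have "\<dots> = (\<Sum>m<Suc j. \<Sum>i\<in>I. ((R ^^ m) f \<bullet> c i)\<^sup>2)"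
    by (rule sum.swap)
  finally show "(norm f)\<^sup>2 = (norm ((R ^^ Suc j) f))\<^sup>2
      + (\<Sum>p\<in>I \<times> {..<Suc j}. (f \<bullet> (case p of (i, m) \<Rightarrow> (R' ^^ m) (c i)))\<^sup>2)"
    using energy_pow[OF f, of "Suc j"] by argo
next
  fix y
  obtain \<epsilon> where \<epsilon>: "\<epsilon> \<longlonglongrightarrow> 0" "\<And>l x. \<bar>y \<bullet> (T ^^ l) x\<bar> \<le> \<epsilon> l * norm x"
    using pure[of y] by blast
  have "(\<epsilon> \<circ> (\<lambda>l. Suc j * l)) \<longlonglongrightarrow> 0"
    using \<epsilon>(1) by (rule LIMSEQ_subseq_LIMSEQ) (rule strict_mono_mult_Suc)
  moreover have "\<bar>y \<bullet> ((T ^^ Suc j) ^^ l) x\<bar> \<le> (\<epsilon> \<circ> (\<lambda>l. Suc j * l)) l * norm x" for l x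
    using \<epsilon>(2)[of "Suc j * l" x] by (simp only: funpow_mult comp_def)
  ultimately show "\<exists>\<epsilon>. \<epsilon> \<longlonglongrightarrow> 0 \<and> (\<forall>l x. \<bar>y \<bullet> ((T ^^ Suc j) ^^ l) x\<bar> \<le> \<epsilon> l * norm x)"
    by blast
qed

lemma R_pow_generator_tendsto_0:
  assumes i: "i \<in> I"
  shows "(\<lambda>k. (R ^^ k) ((R' ^^ j) (c i))) \<longlonglongrightarrow> 0"
proof -
  let ?x = "(R' ^^ j) (c i)"
  have xM: "?x \<in> M" by (intro R'_pow_in c_in i)
  interpret pow: leaking_contraction M "R ^^ Suc j" "T ^^ Suc j" "I \<times> {..<Suc j}"
      "\<lambda>(i, m). (R' ^^ m) (c i)" "\<lambda>(i, m). (T ^^ m) (\<theta> i)"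
    by (rule leaking_contraction_pow)
  have "(\<lambda>k. ((R ^^ Suc j) ^^ k) ?x) \<longlonglongrightarrow> 0"
    using pow.R_pow_channel_tendsto_0[of "(i, j)"] i by simp
  then have lim: "(\<lambda>k. norm ((R ^^ (Suc j * k)) ?x)) \<longlonglongrightarrow> 0"
    by (simp only: funpow_mult tendsto_norm_zero_iff)
  have "decseq (\<lambda>k. norm ((R ^^ k) ?x))"
    unfolding decseq_Suc_iff using norm_R_pow_decreasing[OF xM, of _ 1] by simp
  moreover from this obtain \<delta> where \<delta>: "(\<lambda>k. norm ((R ^^ k) ?x)) \<longlonglongrightarrow> \<delta>"
    using decseq_convergent[of "\<lambda>k. norm ((R ^^ k) ?x)" 0] by auto
  ultimately have "((\<lambda>k. norm ((R ^^ k) ?x)) \<circ> (\<lambda>k. Suc j * k)) \<longlonglongrightarrow> \<delta>"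
    by (intro LIMSEQ_subseq_LIMSEQ[OF \<delta>]) (rule strict_mono_mult_Suc)
  with lim have "\<delta> = 0" unfolding comp_def by (rule LIMSEQ_unique[symmetric])
  with \<delta> show ?thesis by (simp add: tendsto_norm_zero_iff)
qed

text \<open>The vectors with \<open>R\<^sup>k f \<longlonglongrightarrow> 0\<close> form a closed subspace containing all \<open>R'\<^sup>j c\<^sub>i\<close>. A vector of \<open>M\<close>
  orthogonal to all of these has no output at any time, so it vanishes by \<open>unobservable_zero\<close>.\<close>

theorem R_pow_tendsto_0:
  assumes f: "f \<in> M"
  shows "(\<lambda>k. (R ^^ k) f) \<longlonglongrightarrow> 0"
proof -
  define N where "N = {x \<in> M. (\<lambda>k. (R ^^ k) x) \<longlonglongrightarrow> 0}"
  have lin: "linear (R ^^ k)" for k by (rule linear_funpow[OF linear_R])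
  have sub: "subspace N"
    unfolding subspace_def N_def
  proof (intro conjI ballI allI)
    show "0 \<in> {x \<in> M. (\<lambda>k. (R ^^ k) x) \<longlonglongrightarrow> 0}"
      using subspace_0[OF subspace_M] by (simp add: linear_0[OF lin])
    fix x y r assume x: "x \<in> {x \<in> M. (\<lambda>k. (R ^^ k) x) \<longlonglongrightarrow> 0}"
    then have xM: "x \<in> M" and x0: "(\<lambda>k. (R ^^ k) x) \<longlonglongrightarrow> 0" by auto
    show "r *\<^sub>R x \<in> {x \<in> M. (\<lambda>k. (R ^^ k) x) \<longlonglongrightarrow> 0}"
      using subspace_scale[OF subspace_M xM] tendsto_scaleR[OF tendsto_const[of r] x0]
      by (simp add: linear_scale[OF lin])
    assume "y \<in> {x \<in> M. (\<lambda>k. (R ^^ k) x) \<longlonglongrightarrow> 0}"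
    then show "x + y \<in> {x \<in> M. (\<lambda>k. (R ^^ k) x) \<longlonglongrightarrow> 0}"
      using subspace_add[OF subspace_M xM, of y] tendsto_add[OF x0, of "\<lambda>k. (R ^^ k) y" 0]
      by (simp add: linear_add[OF lin])
  qed
  have "closed N"
    unfolding closed_sequential_limits
  proof (intro allI impI)
    fix s x assume sx: "(\<forall>n. s n \<in> N) \<and> s \<longlonglongrightarrow> x"
    have sM: "s n \<in> M" for n using sx by (simp add: N_def)
    have xM: "x \<in> M" using closed_M sM sx by (meson closed_sequentially)
    have "\<exists>K. \<forall>k\<ge>K. norm ((R ^^ k) x - 0) < r" if r: "r > 0" for r :: real
    proof -
      obtain n where n: "norm (s n - x) < r / 2"
        using sx r LIMSEQ_D[of s x "r / 2"] by auto
      have "(\<lambda>k. (R ^^ k) (s n)) \<longlonglongrightarrow> 0" using sx by (simp add: N_def)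
      then obtain K where K: "\<And>k. k \<ge> K \<Longrightarrow> norm ((R ^^ k) (s n)) < r / 2"
        using r LIMSEQ_D[of "\<lambda>k. (R ^^ k) (s n)" 0 "r / 2"] by auto
      have "norm ((R ^^ k) x) < r" if "k \<ge> K" for k
      proof -
        have "norm ((R ^^ k) x) \<le> norm ((R ^^ k) (s n)) + norm ((R ^^ k) (s n - x))"
          unfolding linear_diff[OF lin]
          using norm_triangle_ineq4[of "(R ^^ k) (s n)" "(R ^^ k) (s n) - (R ^^ k) x"] by simp
        also have "norm ((R ^^ k) (s n - x)) \<le> norm (s n - x)"
          by (intro norm_R_pow_le subspace_diff subspace_M sM xM)
        finally show ?thesis using K[OF that] n by simp
      qed
      then show ?thesis by auto
    qed
    then have "(\<lambda>k. (R ^^ k) x) \<longlonglongrightarrow> 0" by (rule LIMSEQ_I)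
    with xM show "x \<in> N" by (simp add: N_def)
  qed
  let ?r = "f - projection N f"
  have pN: "projection N f \<in> N" by (rule projection_in[OF sub \<open>closed N\<close>])
  have rM: "?r \<in> M" using f pN by (intro subspace_diff subspace_M) (auto simp: N_def)
  have "?r = 0"
  proof (rule unobservable_zero[OF rM])
    fix k i assume "i \<in> I"
    then have "(R' ^^ k) (c i) \<in> N"
      by (simp add: N_def R'_pow_in c_in R_pow_generator_tendsto_0)
    then show "(R ^^ k) ?r \<bullet> c i = 0"
      unfolding adjoint_pow by (rule projection_residual[OF sub \<open>closed N\<close>])
  qed
  with pN show ?thesis by (simp add: N_def)
qed

end

section \<open>The Hardy space as a Hilbert space with a shift\<close>

lemma norm_hardy_sums: "(\<lambda>k. (norm (fps_nth (power_series F) k))\<^sup>2) sums (norm F)\<^sup>2"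
proof -
  have "summable (\<lambda>k. (norm (fps_nth (power_series F) k))\<^sup>2)" using power_series[of F] by simp
  then show ?thesis
    by (simp add: power2_norm_eq_inner inner_hardy.rep_eq summable_sums)
qed

lemma hardy_eqI: "(\<And>k. fps_nth (power_series F) k = fps_nth (power_series G) k) \<Longrightarrow> F = G"
  by (simp add: power_series_inject[symmetric] fps_eq_iff)

lemma norm_coeff_le: "norm (fps_nth (power_series F) k) \<le> norm F"
proof (rule power2_le_imp_le)
  have "(\<Sum>j\<in>{k}. (norm (fps_nth (power_series F) j))\<^sup>2)
      \<le> (\<Sum>j. (norm (fps_nth (power_series F) j))\<^sup>2)"
    using norm_hardy_sums[of F] by (intro sum_le_suminf) (auto simp: sums_iff)
  also have "\<dots> = (norm F)\<^sup>2" using norm_hardy_sums[of F] by (simp add: sums_iff)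
  finally show "(norm (fps_nth (power_series F) k))\<^sup>2 \<le> (norm F)\<^sup>2" by simp
qed simp

text \<open>As for \<open>\<ell>\<^sup>2\<close>: the coefficientwise limit of a Cauchy sequence is its limit in norm.\<close>

instance hardy :: ("{real_inner, complete_space}") complete_space
proof
  fix X :: "nat \<Rightarrow> 'a hardy"
  assume X: "Cauchy X"
  let ?x = "\<lambda>n k. fps_nth (power_series (X n)) k"
  have "Cauchy (\<lambda>n. ?x n k)" for k
  proof (rule CauchyI)
    fix r :: real assume "0 < r"
    with X obtain K where K: "\<And>m n. m \<ge> K \<Longrightarrow> n \<ge> K \<Longrightarrow> norm (X m - X n) < r"
      by (meson CauchyD)
    have "norm (?x m k - ?x n k) < r" if "m \<ge> K" "n \<ge> K" for m n
      using norm_coeff_le[of "X m - X n" k] K[OF that] by (simp add: minus_hardy.rep_eq)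
    then show "\<exists>K. \<forall>m\<ge>K. \<forall>n\<ge>K. norm (?x m k - ?x n k) < r" by blast
  qed
  then have "\<forall>k. \<exists>l. (\<lambda>n. ?x n k) \<longlonglongrightarrow> l" by (meson Cauchy_convergent convergent_def)
  then obtain L where L: "\<And>k. (\<lambda>n. ?x n k) \<longlonglongrightarrow> L k" by metis
  have tail: "\<exists>K. \<forall>n\<ge>K. summable (\<lambda>k. (norm (?x n k - L k))\<^sup>2)
      \<and> (\<Sum>k. (norm (?x n k - L k))\<^sup>2) \<le> r\<^sup>2" if "r > 0" for r
  proof -
    from X that obtain K where K: "\<And>m n. m \<ge> K \<Longrightarrow> n \<ge> K \<Longrightarrow> norm (X m - X n) < r"
      by (meson CauchyD)
    have "summable (\<lambda>k. (norm (?x n k - L k))\<^sup>2) \<and> (\<Sum>k. (norm (?x n k - L k))\<^sup>2) \<le> r\<^sup>2"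
      if n: "n \<ge> K" for n
    proof -
      have part: "(\<Sum>k<J. (norm (?x n k - L k))\<^sup>2) \<le> r\<^sup>2" for J
      proof (rule LIMSEQ_le_const2)
        show "(\<lambda>m. \<Sum>k<J. (norm (?x n k - ?x m k))\<^sup>2) \<longlonglongrightarrow> (\<Sum>k<J. (norm (?x n k - L k))\<^sup>2)"
          by (intro tendsto_intros L)
        have "(\<Sum>k<J. (norm (?x n k - ?x m k))\<^sup>2) \<le> r\<^sup>2" if "m \<ge> K" for m
        proof -
          have sums: "(\<lambda>k. (norm (?x n k - ?x m k))\<^sup>2) sums (norm (X n - X m))\<^sup>2"
            using norm_hardy_sums[of "X n - X m"] by (simp add: minus_hardy.rep_eq)
          have "(\<Sum>k<J. (norm (?x n k - ?x m k))\<^sup>2) \<le> (\<Sum>k. (norm (?x n k - ?x m k))\<^sup>2)"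
            using sums by (intro sum_le_suminf) (auto simp: sums_iff)
          also have "\<dots> = (norm (X n - X m))\<^sup>2" using sums by (simp add: sums_iff)
          also have "\<dots> \<le> r\<^sup>2" using K[OF n that] by (intro power_mono) auto
          finally show ?thesis .
        qed
        then show "\<exists>N. \<forall>m\<ge>N. (\<Sum>k<J. (norm (?x n k - ?x m k))\<^sup>2) \<le> r\<^sup>2" by blast
      qed
      have "summable (\<lambda>k. (norm (?x n k - L k))\<^sup>2)"
        by (rule summableI_nonneg_bounded[OF _ part]) simp
      moreover from this have "(\<Sum>k. (norm (?x n k - L k))\<^sup>2) \<le> r\<^sup>2"
        by (rule suminf_le_const) (rule part)
      ultimately show ?thesis by blast
    qed
    then show ?thesis by blast
  qed
  obtain K where "summable (\<lambda>k. (norm (?x K k - L k))\<^sup>2)" using tail[of 1] by auto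
  then have "summable (\<lambda>k. (norm (?x K k + - (?x K k - L k)))\<^sup>2)"
    using power_series[of "X K"] by (intro summable_square_add) (auto simp: norm_minus_commute)
  then have Lsum: "Abs_fps L \<in> {F. summable (\<lambda>k. (norm (fps_nth F k))\<^sup>2)}" by simp
  define Y where "Y = Abs_hardy (Abs_fps L)"
  have Y: "fps_nth (power_series Y) k = L k" for k
    using Lsum by (simp add: Y_def Abs_hardy_inverse)
  have "X \<longlonglongrightarrow> Y"
  proof (rule LIMSEQ_I)
    fix r :: real assume r: "0 < r"
    then obtain K where K: "\<And>n. n \<ge> K \<Longrightarrow> (\<Sum>k. (norm (?x n k - L k))\<^sup>2) \<le> (r / 2)\<^sup>2"
      using tail[of "r / 2"] by auto
    have "norm (X n - Y) < r" if "n \<ge> K" for n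
    proof -
      have "(norm (X n - Y))\<^sup>2 \<le> (r / 2)\<^sup>2"
        using K[OF that] norm_hardy_sums[of "X n - Y"] by (simp add: sums_iff minus_hardy.rep_eq Y)
      then have "norm (X n - Y) \<le> r / 2" by (rule power2_le_imp_le) (use r in simp)
      then show ?thesis using r by simp
    qed
    then show "\<exists>K. \<forall>n\<ge>K. norm (X n - Y) < r" by blast
  qed
  then show "convergent X" by (rule convergentI)
qed

lift_definition forward_shift :: "real hardy \<Rightarrow> real hardy" is "\<lambda>F. fps_X * F"
proof -
  fix F :: "real fps"
  assume "summable (\<lambda>k. (norm (fps_nth F k))\<^sup>2)"
  then have "summable (\<lambda>k. (norm (fps_nth (fps_X * F) (Suc k)))\<^sup>2)" by simp
  then show "summable (\<lambda>k. (norm (fps_nth (fps_X * F) k))\<^sup>2)" by (subst (asm) summable_Suc_iff)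
qed

lemma linear_forward_shift: "linear forward_shift"
proof (rule linearI)
  show "forward_shift (F + G) = forward_shift F + forward_shift G" for F G
    by transfer (simp add: algebra_simps)
  show "forward_shift (r *\<^sub>R F) = r *\<^sub>R forward_shift F" for r F
    by transfer (simp add: fps_eq_iff)
qed

lemma linear_backward_shift: "linear (backward_shift :: 'a::real_inner hardy \<Rightarrow> 'a hardy)"
proof (rule linearI)
  show "backward_shift (F + G) = backward_shift F + backward_shift G" for F G :: "'a hardy"
    by transfer (simp add: fps_eq_iff)
  show "backward_shift (r *\<^sub>R F) = r *\<^sub>R backward_shift F" for r and F :: "'a hardy"
    by transfer (simp add: fps_eq_iff)
qed

lemma backward_forward_shift: "backward_shift (forward_shift F) = F"
  by transfer (simp add: fps_eq_iff)

lemma forward_backward_shift: "f \<in> zH2 \<Longrightarrow> forward_shift (backward_shift f) = f"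
  unfolding zH2_def mem_Collect_eq by transfer (auto simp: fps_eq_iff)

lemma forward_shift_adjoint: "forward_shift x \<bullet> y = x \<bullet> backward_shift y"
proof -
  have "summable (\<lambda>k. fps_nth (power_series (forward_shift x)) k \<bullet> fps_nth (power_series y) k)"
    using power_series[of "forward_shift x"] power_series[of y] by (intro summable_square_inner) auto
  then have "forward_shift x \<bullet> y
      = (\<Sum>k. fps_nth (power_series (forward_shift x)) (Suc k) \<bullet> fps_nth (power_series y) (Suc k))"
    unfolding inner_hardy.rep_eq by (subst suminf_split_head) (auto simp: forward_shift.rep_eq)
  then show ?thesis by (simp add: inner_hardy.rep_eq forward_shift.rep_eq backward_shift.rep_eq)
qed

lemma norm_forward_shift: "norm (forward_shift x) = norm x"
  by (simp add: norm_eq_sqrt_inner forward_shift_adjoint backward_forward_shift)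

lemma coeff_backward_shift_pow:
  "fps_nth (power_series ((backward_shift ^^ l) F)) k = fps_nth (power_series F) (k + l)"
  by (induction l arbitrary: k) (auto simp: backward_shift.rep_eq)

lemma backward_shift_pow_tendsto_0: "(\<lambda>l. norm ((backward_shift ^^ l) F)) \<longlonglongrightarrow> 0"
proof -
  have "summable (\<lambda>k. (norm (fps_nth (power_series F) k))\<^sup>2)" using power_series[of F] by simp
  from suminf_exist_split2[OF this]
  have "(\<lambda>l. sqrt (\<Sum>k. (norm (fps_nth (power_series F) (k + l)))\<^sup>2)) \<longlonglongrightarrow> sqrt 0"
    by (rule tendsto_real_sqrt)
  moreover have "norm ((backward_shift ^^ l) F) = sqrt (\<Sum>k. (norm (fps_nth (power_series F) (k + l)))\<^sup>2)" for l
    using norm_hardy_sums[of "(backward_shift ^^ l) F"]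
    by (simp add: sums_iff coeff_backward_shift_pow real_sqrt_unique)
  ultimately show ?thesis by simp
qed

text \<open>The adjoint of the shift is the backward shift, which removes the first coefficients one by one.\<close>

lemma forward_shift_pure:
  "\<exists>\<epsilon>. \<epsilon> \<longlonglongrightarrow> 0 \<and> (\<forall>l x. \<bar>y \<bullet> (forward_shift ^^ l) x\<bar> \<le> \<epsilon> l * norm x)"
proof (intro exI conjI allI)
  show "(\<lambda>l. norm ((backward_shift ^^ l) y)) \<longlonglongrightarrow> 0" by (rule backward_shift_pow_tendsto_0)
  fix l x
  have "y \<bullet> (forward_shift ^^ l) x = (backward_shift ^^ l) y \<bullet> x"
    by (induction l arbitrary: y x)
       (simp_all add: funpow_swap1 inner_commute[of _ "forward_shift _"] forward_shift_adjoint inner_commute)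
  then show "\<bar>y \<bullet> (forward_shift ^^ l) x\<bar> \<le> norm ((backward_shift ^^ l) y) * norm x"
    by (simp add: Cauchy_Schwarz_ineq2)
qed

text \<open>Evaluation at \<open>0\<close> is the inner product with the constant function \<open>1\<close>, so \<open>zH2\<close> is a closed
  hyperplane.\<close>

lift_definition constant_one :: "real hardy" is 1
  by (rule summable_finite[of "{0}"]) auto

lemma inner_constant_one: "constant_one \<bullet> f = fps_nth (power_series f) 0"
proof -
  have "(\<lambda>k. fps_nth (power_series constant_one) k \<bullet> fps_nth (power_series f) k)
      sums (\<Sum>k\<in>{0}. fps_nth (power_series constant_one) k \<bullet> fps_nth (power_series f) k)"
    by (rule sums_finite) (auto simp: constant_one.rep_eq)
  then show ?thesis by (simp add: inner_hardy.rep_eq sums_iff constant_one.rep_eq)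
qed

lemma mem_zH2_iff: "f \<in> zH2 \<longleftrightarrow> fps_nth (power_series f) 0 = 0"
proof
  assume "fps_nth (power_series f) 0 = 0"
  then have "power_series f = fps_X * power_series (backward_shift f)"
    by (simp add: fps_eq_iff backward_shift.rep_eq)
  then show "f \<in> zH2" unfolding zH2_def by blast
qed (auto simp: zH2_def)

lemma zH2_hyperplane: "zH2 = {f. constant_one \<bullet> f = 0}"
  by (auto simp: mem_zH2_iff inner_constant_one)

lemma subspace_zH2: "subspace zH2"
  unfolding zH2_hyperplane by (rule subspace_hyperplane)

lemma closed_zH2: "closed zH2"
  unfolding zH2_hyperplane by (rule closed_hyperplane)

lift_definition tuple :: "('m::finite \<Rightarrow> real hardy) \<Rightarrow> (real ^ 'm) hardy"
  is "\<lambda>f. Abs_fps (\<lambda>k. \<chi> i. fps_nth (f i) k)"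
proof -
  fix f :: "'m \<Rightarrow> real fps"
  assume f: "\<And>i. summable (\<lambda>k. (norm (fps_nth (f i) k))\<^sup>2)"
  have "summable (\<lambda>k. \<Sum>i\<in>UNIV. (norm (fps_nth (f i) k))\<^sup>2)" by (intro summable_sum f)
  then show "summable (\<lambda>k. (norm (fps_nth (Abs_fps (\<lambda>k. \<chi> i. fps_nth (f i) k)) k))\<^sup>2)"
    by (simp add: norm_vec_def L2_set_def sum_nonneg)
qed

lemma component_tuple: "component i (tuple f) = f i"
  by (rule hardy_eqI) (simp add: component.rep_eq tuple.rep_eq)

lemma norm_components: "(norm F)\<^sup>2 = (\<Sum>i\<in>UNIV. (norm (component i F))\<^sup>2)"
proof -
  have "(\<lambda>k. \<Sum>i\<in>UNIV. (norm (fps_nth (power_series (component i F)) k))\<^sup>2)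
      sums (\<Sum>i\<in>UNIV. (norm (component i F))\<^sup>2)"
    by (intro sums_sum norm_hardy_sums)
  moreover have "(\<Sum>i\<in>UNIV. (norm (fps_nth (power_series (component i F)) k))\<^sup>2)
      = (norm (fps_nth (power_series F) k))\<^sup>2" for k
    by (simp add: component.rep_eq norm_vec_def L2_set_def sum_nonneg)
  ultimately show ?thesis using norm_hardy_sums[of F] by (simp add: sums_iff)
qed

section \<open>Output functions\<close>

locale hardy_leaking_contraction =
  leaking_contraction_adjoint M R forward_shift I c \<theta> R'
  for M :: "real hardy set" and R R' :: "real hardy \<Rightarrow> real hardy"
    and I :: "'i set" and c \<theta> :: "'i \<Rightarrow> real hardy"
begin

definition output_series :: "'i \<Rightarrow> real hardy \<Rightarrow> real hardy"
  where "output_series i f = Abs_hardy (Abs_fps (\<lambda>k. (R ^^ k) f \<bullet> c i))"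

text \<open>Square summability of the coefficients is known for starting points in \<open>M\<close>. It holds for every
  \<open>f\<close> because \<open>R f\<close> lies in \<open>M\<close>, which makes \<open>output_series i\<close> linear on the whole space.\<close>

lemma coeff_output_series:
  assumes "i \<in> I"
  shows "fps_nth (power_series (output_series i f)) k = (R ^^ k) f \<bullet> c i"
proof -
  have "summable (\<lambda>k. ((R ^^ Suc k) f \<bullet> c i)\<^sup>2)"
    using summable_output[OF R_in[of f] assms] by (simp add: funpow_swap1)
  then have "summable (\<lambda>k. ((R ^^ k) f \<bullet> c i)\<^sup>2)" by (subst (asm) summable_Suc_iff)
  then show ?thesis by (simp add: output_series_def Abs_hardy_inverse)
qed

lemma linear_output_series:
  assumes "i \<in> I"
  shows "linear (output_series i)"
  by (rule linearI; rule hardy_eqI)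
     (simp_all add: coeff_output_series[OF assms] plus_hardy.rep_eq scaleR_hardy.rep_eq
       linear_add[OF linear_funpow[OF linear_R]] linear_scale[OF linear_funpow[OF linear_R]]
       inner_add_left)

lemma backward_shift_output_series:
  assumes "i \<in> I"
  shows "backward_shift (output_series i f) = output_series i (R f)"
  by (rule hardy_eqI) (simp add: backward_shift.rep_eq coeff_output_series[OF assms] funpow_swap1)

text \<open>The energy balance over \<open>K\<close> steps has the remainder \<open>\<parallel>R\<^sup>K f\<parallel>\<^sup>2\<close>; this is where strong stability of
  \<open>R\<close> is needed.\<close>

lemma norm_output_series:
  assumes f: "f \<in> M"
  shows "(norm f)\<^sup>2 = (\<Sum>i\<in>I. (norm (output_series i f))\<^sup>2)"
proof -
  have "(\<lambda>k. \<Sum>i\<in>I. ((R ^^ k) f \<bullet> c i)\<^sup>2) sums (\<Sum>i\<in>I. (norm (output_series i f))\<^sup>2)"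
  proof (rule sums_sum)
    show "(\<lambda>k. ((R ^^ k) f \<bullet> c i)\<^sup>2) sums (norm (output_series i f))\<^sup>2" if "i \<in> I" for i
      using norm_hardy_sums[of "output_series i f"] by (simp add: coeff_output_series[OF that])
  qed
  then have "(\<lambda>K. (norm ((R ^^ K) f))\<^sup>2 + (\<Sum>k<K. \<Sum>i\<in>I. ((R ^^ k) f \<bullet> c i)\<^sup>2))
      \<longlonglongrightarrow> (norm (0 :: real hardy))\<^sup>2 + (\<Sum>i\<in>I. (norm (output_series i f))\<^sup>2)"
    unfolding sums_def by (intro tendsto_intros R_pow_tendsto_0 f)
  then have "(\<lambda>K. (norm f)\<^sup>2) \<longlonglongrightarrow> (\<Sum>i\<in>I. (norm (output_series i f))\<^sup>2)"
    unfolding energy_pow[OF f, symmetric] by simp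
  then show ?thesis by (simp add: LIMSEQ_const_iff)
qed

text \<open>The difference \<open>E f\<close> of the two sides satisfies \<open>E f = z E (R f)\<close> on \<open>M\<close>, so all its coefficients
  vanish. As it concerns formal power series, no convergence of the iterated expansion
  is involved.\<close>

lemma power_series_output_series:
  assumes "f \<in> M"
  shows "power_series f = (\<Sum>i\<in>I. power_series (\<theta> i) * power_series (output_series i f))"
proof -
  define E where "E f = power_series f
    - (\<Sum>i\<in>I. power_series (\<theta> i) * power_series (output_series i f))" for f
  have rec: "E f = fps_X * E (R f)" if f: "f \<in> M" for f
  proof -
    have out: "power_series (output_series i f)
        = fps_const (f \<bullet> c i) + fps_X * power_series (output_series i (R f))" if "i \<in> I" for i
    proof (rule fps_ext)
      fix k show "fps_nth (power_series (output_series i f)) k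
          = fps_nth (fps_const (f \<bullet> c i) + fps_X * power_series (output_series i (R f))) k"
        using that by (cases k) (simp_all add: coeff_output_series funpow_swap1)
    qed
    have sum_rep: "power_series (\<Sum>i\<in>I. a i *\<^sub>R \<theta> i) = (\<Sum>i\<in>I. fps_const (a i) * power_series (\<theta> i))" for a
      using finite_I
      by (induction I rule: finite_induct)
         (simp_all add: zero_hardy.rep_eq plus_hardy.rep_eq scaleR_hardy.rep_eq fps_eq_iff)
    have "power_series f = power_series (forward_shift (R f) + (\<Sum>i\<in>I. (f \<bullet> c i) *\<^sub>R \<theta> i))"
      using expand[OF f] by simp
    also have "\<dots> = fps_X * power_series (R f) + (\<Sum>i\<in>I. fps_const (f \<bullet> c i) * power_series (\<theta> i))"
      unfolding plus_hardy.rep_eq forward_shift.rep_eq sum_rep ..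
    finally have 1: "power_series f
        = fps_X * power_series (R f) + (\<Sum>i\<in>I. fps_const (f \<bullet> c i) * power_series (\<theta> i))" .
    have 2: "(\<Sum>i\<in>I. power_series (\<theta> i) * power_series (output_series i f))
        = (\<Sum>i\<in>I. fps_const (f \<bullet> c i) * power_series (\<theta> i))
          + fps_X * (\<Sum>i\<in>I. power_series (\<theta> i) * power_series (output_series i (R f)))"
      by (simp add: out distrib_left sum.distrib sum_distrib_left mult_ac)
    show ?thesis unfolding E_def 1 2 by (simp add: right_diff_distrib)
  qed
  have "\<forall>f\<in>M. fps_nth (E f) k = 0" for k
  proof (induction k)
    case 0
    show ?case
    proof
      fix f assume "f \<in> M"
      show "fps_nth (E f) 0 = 0" by (subst rec[OF \<open>f \<in> M\<close>]) simp
    qed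
  next
    case (Suc k)
    show ?case
    proof
      fix f assume "f \<in> M"
      show "fps_nth (E f) (Suc k) = 0" by (subst rec[OF \<open>f \<in> M\<close>]) (use Suc R_in in simp)
    qed
  qed
  then have "E f = 0" using assms by (simp add: fps_eq_iff)
  then show ?thesis by (simp add: E_def)
qed

end

section \<open>The contraction of a nearly invariant subspace\<close>

lemma sum_UNIV_option:
  fixes t :: "'n::finite option \<Rightarrow> 'b::comm_monoid_add"
  shows "(\<Sum>i\<in>UNIV. t i) = t None + (\<Sum>i\<in>UNIV. t (Some i))"
  by (simp add: UNIV_option_conv sum.reindex)

lemma orthonormal_expansion:
  fixes e :: "'n::finite \<Rightarrow> 'a::real_inner"
  assumes e: "\<And>i j. e i \<bullet> e j = (if i = j then 1 else 0)" and u: "u \<in> span (range e)"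
  shows "u = (\<Sum>i\<in>UNIV. (u \<bullet> e i) *\<^sub>R e i)"
  using u
proof (induction u rule: span_induct_alt)
  case (step a x y)
  then obtain j where "x = e j" by blast
  then have "x = (\<Sum>i\<in>UNIV. (x \<bullet> e i) *\<^sub>R e i)" by (simp add: e if_distrib[of "\<lambda>r. r *\<^sub>R _"] cong: if_cong)
  with step have "a *\<^sub>R x + y
      = a *\<^sub>R (\<Sum>i\<in>UNIV. (x \<bullet> e i) *\<^sub>R e i) + (\<Sum>i\<in>UNIV. (y \<bullet> e i) *\<^sub>R e i)"
    by metis
  also have "\<dots> = (\<Sum>i\<in>UNIV. ((a *\<^sub>R x + y) \<bullet> e i) *\<^sub>R e i)"
    by (simp add: inner_add_left scaleR_add_left sum.distrib scaleR_sum_right)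
  finally show ?case .
qed simp

lemma norm_orthonormal_expansion:
  fixes e :: "'n::finite \<Rightarrow> 'a::real_inner"
  assumes e: "\<And>i j. e i \<bullet> e j = (if i = j then 1 else 0)" and u: "u \<in> span (range e)"
  shows "(norm u)\<^sup>2 = (\<Sum>i\<in>UNIV. (u \<bullet> e i)\<^sup>2)"
proof -
  have "(norm u)\<^sup>2 = u \<bullet> (\<Sum>i\<in>UNIV. (u \<bullet> e i) *\<^sub>R e i)"
    unfolding power2_norm_eq_inner using orthonormal_expansion[OF e u] by simp
  then show ?thesis by (simp add: inner_sum_right power2_eq_square)
qed

locale nearly_invariant_subspace =
  fixes M D :: "real hardy set" and e :: "'n::finite \<Rightarrow> real hardy"
  assumes subspace_M: "subspace M" and closed_M: "closed M"
    and near: "near_invariance_space M D" and basis: "orthonormal_basis e D"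
begin

definition "M\<^sub>0 = M \<inter> zH2"

text \<open>On \<open>M\<close> the operator removes the part of \<open>f\<close> orthogonal to \<open>M \<inter> zH2\<close>, divides by \<open>z\<close>, and drops the
  component in the defect space. Composing with projections defines it on all of the Hardy space
  and makes its adjoint explicit.\<close>

definition near_shift :: "real hardy \<Rightarrow> real hardy"
  where "near_shift f = projection M (backward_shift (projection M\<^sub>0 f))"

definition near_shift_adj :: "real hardy \<Rightarrow> real hardy"
  where "near_shift_adj f = projection M\<^sub>0 (forward_shift (projection M f))"

definition channel :: "'n \<Rightarrow> real hardy"
  where "channel i = projection M\<^sub>0 (forward_shift (e i))"

lemma subspace_M\<^sub>0: "subspace M\<^sub>0" and closed_M\<^sub>0: "closed M\<^sub>0"
  unfolding M\<^sub>0_def using subspace_M closed_M subspace_zH2 closed_zH2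
  by (auto intro: subspace_inter)

lemmas M_projection = subspace_M closed_M and M\<^sub>0_projection = subspace_M\<^sub>0 closed_M\<^sub>0

lemma linear_near_shift: "linear near_shift"
  unfolding near_shift_def[abs_def]
  using linear_compose[OF linear_compose[OF linear_projection[OF M\<^sub>0_projection] linear_backward_shift]
      linear_projection[OF M_projection]]
  by (simp add: comp_def)

lemma near_shift_in: "near_shift f \<in> M"
  unfolding near_shift_def by (rule projection_in[OF M_projection])

lemma near_shift_adj_in: "near_shift_adj f \<in> M\<^sub>0"
  unfolding near_shift_adj_def by (rule projection_in[OF M\<^sub>0_projection])

lemma channel_in: "channel i \<in> M\<^sub>0"
  unfolding channel_def by (rule projection_in[OF M\<^sub>0_projection])

lemma near_shift_adjoint: "near_shift x \<bullet> y = x \<bullet> near_shift_adj y"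
  unfolding near_shift_def near_shift_adj_def
  using forward_shift_adjoint[of "projection M y" "projection M\<^sub>0 x"]
  by (metis projection_self_adjoint[OF M_projection] projection_self_adjoint[OF M\<^sub>0_projection]
      inner_commute)

text \<open>
  Write \<open>p\<close> for the projection of \<open>f\<close> to \<open>M \<inter> zH2\<close>. Near invariance splits \<open>p / z\<close> into \<open>m + u\<close> with
  \<open>m \<in> M\<close> and \<open>u\<close> in the defect space. As these are orthogonal, \<open>m\<close> is \<open>near_shift f\<close>, and the coordinates
  of \<open>u\<close> are \<open>(p / z) \<bullet> e\<^sub>i = p \<bullet> z e\<^sub>i = f \<bullet> channel i\<close>.\<close>

lemma
  shows near_shift_expand: "projection M\<^sub>0 f = forward_shift (near_shift f)
      + (\<Sum>i\<in>UNIV. (f \<bullet> channel i) *\<^sub>R forward_shift (e i))" (is ?expand)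
    and near_shift_energy: "(norm (projection M\<^sub>0 f))\<^sup>2
      = (norm (near_shift f))\<^sup>2 + (\<Sum>i\<in>UNIV. (f \<bullet> channel i)\<^sup>2)" (is ?energy)
proof -
  let ?p = "projection M\<^sub>0 f"
  have ortho: "\<And>i j. e i \<bullet> e j = (if i = j then 1 else 0)" and span: "span (range e) = D"
    using basis by (auto simp: orthonormal_basis_def)
  have MD: "m \<bullet> u = 0" if "m \<in> M" "u \<in> D" for m u
    using near that by (auto simp: near_invariance_space_def orthogonal_def)
  have eD: "e i \<in> D" for i using span span_base[of "e i" "range e"] by auto
  have p: "?p \<in> M\<^sub>0" by (rule projection_in[OF M\<^sub>0_projection])
  then have "backward_shift ?p \<in> {m + u | m u. m \<in> M \<and> u \<in> D}"
    using near by (auto simp: near_invariance_space_def M\<^sub>0_def)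
  then obtain m u where mu: "backward_shift ?p = m + u" "m \<in> M" "u \<in> D" by blast
  have m: "near_shift f = m"
    unfolding near_shift_def mu(1)
    by (rule projection_unique[OF M_projection mu(2)]) (use MD[OF _ mu(3)] in \<open>simp add: inner_commute\<close>)
  have coeff: "u \<bullet> e i = f \<bullet> channel i" for i
  proof -
    have "u \<bullet> e i = backward_shift ?p \<bullet> e i" using MD[OF mu(2) eD] by (simp add: mu(1) inner_add_left)
    also have "\<dots> = ?p \<bullet> forward_shift (e i)"
      using forward_shift_adjoint[of "e i" ?p] by (simp add: inner_commute)
    finally show ?thesis unfolding channel_def by (simp add: projection_self_adjoint[OF M\<^sub>0_projection])
  qed
  have u: "u \<in> span (range e)" using mu(3) span by simp
  have fb: "?p = forward_shift (m + u)"
    using p forward_backward_shift[of ?p] mu(1) by (simp add: M\<^sub>0_def)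
  have "forward_shift u = (\<Sum>i\<in>UNIV. (f \<bullet> channel i) *\<^sub>R forward_shift (e i))"
    by (subst orthonormal_expansion[OF ortho u])
       (simp add: coeff linear_sum[OF linear_forward_shift] linear_scale[OF linear_forward_shift])
  then show ?expand using fb by (simp add: m linear_add[OF linear_forward_shift])
  have "(norm ?p)\<^sup>2 = (norm (m + u))\<^sup>2" using fb by (simp add: norm_forward_shift)
  also have "\<dots> = (norm m)\<^sup>2 + (norm u)\<^sup>2"
    using MD[OF mu(2,3)] by (simp add: power2_norm_eq_inner inner_add_left inner_add_right inner_commute)
  finally show ?energy using norm_orthonormal_expansion[OF ortho u] by (simp add: m coeff)
qed

lemma hardy_leaking_contraction_vanishing:
  assumes "M \<subseteq> zH2"
  shows "hardy_leaking_contraction M near_shift near_shift_adj UNIV channel (\<lambda>i. forward_shift (e i))"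
proof -
  have M\<^sub>0: "M\<^sub>0 = M" using assms by (auto simp: M\<^sub>0_def)
  have ident: "f \<in> M \<Longrightarrow> projection M\<^sub>0 f = f" for f
    unfolding M\<^sub>0 by (rule projection_ident[OF M_projection])
  show ?thesis
  proof (intro hardy_leaking_contraction.intro leaking_contraction_adjoint.intro
      leaking_contraction.intro leaking_contraction_adjoint_axioms.intro)
    show "f = forward_shift (near_shift f) + (\<Sum>i\<in>UNIV. (f \<bullet> channel i) *\<^sub>R forward_shift (e i))"
      if "f \<in> M" for f using near_shift_expand[of f] ident[OF that] by simp
    show "(norm f)\<^sup>2 = (norm (near_shift f))\<^sup>2 + (\<Sum>i\<in>UNIV. (f \<bullet> channel i)\<^sup>2)"
      if "f \<in> M" for f using near_shift_energy[of f] ident[OF that] by simp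
    show "channel i \<in> M" "near_shift_adj f \<in> M" for i f
      using channel_in near_shift_adj_in by (auto simp: M\<^sub>0_def)
  qed (rule subspace_M closed_M finite linear_near_shift near_shift_in linear_forward_shift
      norm_forward_shift forward_shift_pure near_shift_adjoint)+
qed

text \<open>Subtracting from \<open>f\<close> the multiple of \<open>g\<close> that cancels \<open>f(0)\<close> leaves an element of \<open>M \<inter> zH2\<close>, which
  is orthogonal to \<open>g\<close>.\<close>

lemma normalized_at_0_decomposition:
  assumes g: "normalized_at_0 M g" and f: "f \<in> M"
  shows "f = projection M\<^sub>0 f + (f \<bullet> g) *\<^sub>R g"
proof -
  let ?v = "\<lambda>f. fps_nth (power_series f) 0"
  have gM: "g \<in> M" and n1: "g \<bullet> g = 1" and g0: "?v g > 0"
    and og: "\<And>m. m \<in> M\<^sub>0 \<Longrightarrow> g \<bullet> m = 0"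
    using g by (auto simp: normalized_at_0_def M\<^sub>0_def orthogonal_def norm_eq_1)
  define q where "q = f - (?v f / ?v g) *\<^sub>R g"
  have "?v q = 0" using g0 by (simp add: q_def minus_hardy.rep_eq scaleR_hardy.rep_eq)
  moreover have "q \<in> M" unfolding q_def by (intro subspace_diff subspace_scale subspace_M f gM)
  ultimately have q: "q \<in> M\<^sub>0" by (simp add: M\<^sub>0_def mem_zH2_iff)
  have pq: "projection M\<^sub>0 f = q"
    by (rule projection_unique[OF M\<^sub>0_projection q]) (simp add: q_def og)
  have fq: "f = q + (?v f / ?v g) *\<^sub>R g" by (simp add: q_def)
  have "f \<bullet> g = q \<bullet> g + (?v f / ?v g) * (g \<bullet> g)" by (subst fq) (simp add: inner_add_left)
  then have "f \<bullet> g = ?v f / ?v g" using og[OF q] by (simp add: n1 inner_commute)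
  with fq pq show ?thesis by simp
qed

text \<open>The component of \<open>f\<close> along \<open>g\<close> is one more channel, of index \<open>None\<close>, with \<open>c = \<theta> = g\<close>.\<close>

lemma hardy_leaking_contraction_normalized:
  assumes g: "normalized_at_0 M g"
  shows "hardy_leaking_contraction M near_shift near_shift_adj UNIV
    (case_option g channel) (case_option g (\<lambda>i. forward_shift (e i)))"
proof -
  have gM: "g \<in> M" and n1: "g \<bullet> g = 1" and og: "\<And>m. m \<in> M\<^sub>0 \<Longrightarrow> m \<bullet> g = 0"
    using g by (auto simp: normalized_at_0_def M\<^sub>0_def orthogonal_def norm_eq_1 inner_commute)
  show ?thesis
  proof (intro hardy_leaking_contraction.intro leaking_contraction_adjoint.intro
      leaking_contraction.intro leaking_contraction_adjoint_axioms.intro)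
    fix f assume f: "f \<in> M"
    note dec = normalized_at_0_decomposition[OF g f]
    show "f = forward_shift (near_shift f) + (\<Sum>i\<in>UNIV.
        (f \<bullet> case_option g channel i) *\<^sub>R case_option g (\<lambda>i. forward_shift (e i)) i)"
      unfolding sum_UNIV_option using dec near_shift_expand[of f] by (simp add: add_ac)
    have "(norm f)\<^sup>2 = (norm (projection M\<^sub>0 f + (f \<bullet> g) *\<^sub>R g))\<^sup>2" using dec by simp
    also have "\<dots> = (norm (projection M\<^sub>0 f))\<^sup>2 + (f \<bullet> g)\<^sup>2"
      using og[OF projection_in[OF M\<^sub>0_projection]] n1
      unfolding power2_norm_eq_inner
      by (simp add: inner_add_left inner_add_right inner_commute power2_eq_square)
    finally show "(norm f)\<^sup>2 = (norm (near_shift f))\<^sup>2 + (\<Sum>i\<in>UNIV. (f \<bullet> case_option g channel i)\<^sup>2)"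
      unfolding sum_UNIV_option using near_shift_energy[of f] by simp
  next
    show "case_option g channel i \<in> M" for i
      using gM channel_in by (auto simp: M\<^sub>0_def split: option.split)
    show "near_shift_adj f \<in> M" for f
      using near_shift_adj_in by (auto simp: M\<^sub>0_def)
  qed (rule subspace_M closed_M finite linear_near_shift near_shift_in linear_forward_shift
      norm_forward_shift forward_shift_pure near_shift_adjoint)+
qed

lemma normalized_at_0_exists:
  assumes f: "f \<in> M" "fps_nth (power_series f) 0 \<noteq> 0"
  shows "\<exists>g. normalized_at_0 M g"
proof -
  let ?v = "\<lambda>f. fps_nth (power_series f) 0"
  define q where "q = f - projection M\<^sub>0 f"
  have pM: "projection M\<^sub>0 f \<in> M\<^sub>0" by (rule projection_in[OF M\<^sub>0_projection])
  then have qv: "?v q = ?v f" by (simp add: q_def minus_hardy.rep_eq M\<^sub>0_def mem_zH2_iff)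
  then have q0: "q \<noteq> 0" using f(2) by (auto simp: zero_hardy.rep_eq)
  define g where "g = (sgn (?v f) / norm q) *\<^sub>R q"
  have "g \<in> M" using pM f(1) unfolding g_def q_def
    by (intro subspace_scale subspace_diff subspace_M) (auto simp: M\<^sub>0_def)
  moreover have "norm g = 1" using q0 f(2) by (simp add: g_def abs_sgn_eq)
  moreover have "orthogonal g m" if "m \<in> M \<inter> zH2" for m
    using projection_residual[OF M\<^sub>0_projection, of m f] that
    by (simp add: g_def q_def orthogonal_def M\<^sub>0_def)
  moreover have "?v g = \<bar>?v f\<bar> / norm q"
    by (simp add: g_def scaleR_hardy.rep_eq qv abs_sgn mult.commute)
  then have "?v g > 0" using q0 f(2) by simp
  ultimately show ?thesis unfolding normalized_at_0_def by blast
qed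

lemma normalized_at_0_unique:
  assumes g: "normalized_at_0 M g" and g': "normalized_at_0 M g'"
  shows "g = g'"
proof -
  have gM: "g \<in> M" and n: "norm g = 1" "norm g' = 1"
    and v: "fps_nth (power_series g) 0 > 0" "fps_nth (power_series g') 0 > 0"
    and og: "\<And>m. m \<in> M\<^sub>0 \<Longrightarrow> g \<bullet> m = 0"
    using g g' by (auto simp: normalized_at_0_def M\<^sub>0_def orthogonal_def)
  have "projection M\<^sub>0 g = 0"
    by (rule projection_unique[OF M\<^sub>0_projection subspace_0[OF subspace_M\<^sub>0]]) (simp add: og)
  then have eq: "g = (g \<bullet> g') *\<^sub>R g'" using normalized_at_0_decomposition[OF g' gM] by simp
  then have "\<bar>g \<bullet> g'\<bar> = 1" using n by (metis mult.right_neutral norm_scaleR)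
  moreover have "fps_nth (power_series g) 0 = (g \<bullet> g') * fps_nth (power_series g') 0"
    by (subst eq) (simp add: scaleR_hardy.rep_eq)
  then have "g \<bullet> g' > 0" using v by (metis zero_less_mult_pos2)
  ultimately show ?thesis using eq by simp
qed

end

section \<open>The representation\<close>

lemma linear_tuple:
  assumes "\<And>i. linear (h i)"
  shows "linear (\<lambda>f. tuple (\<lambda>i. h i f))"
  by (rule linearI; rule hardy_eqI)
     (simp_all add: tuple.rep_eq plus_hardy.rep_eq scaleR_hardy.rep_eq vec_eq_iff
       linear_add[OF assms] linear_scale[OF assms])

lemma backward_shift_tuple: "backward_shift (tuple h) = tuple (\<lambda>i. backward_shift (h i))"
  by (rule hardy_eqI) (simp add: tuple.rep_eq backward_shift.rep_eq vec_eq_iff)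

context nearly_invariant_subspace
begin

text \<open>\<open>N\<close> is the image of \<open>M\<close> under the map \<open>J\<close> that sends \<open>f\<close> to its outputs. Since \<open>J\<close> is isometric, \<open>N\<close> is
  closed; since \<open>J (R f)\<close> is the backward shift of \<open>J f\<close>, it is invariant. The multiplication that recovers
  \<open>f\<close> from \<open>J f\<close> is therefore injective on \<open>N\<close>, so the norm identity holds for
  every representation of \<open>f\<close> by an element of \<open>N\<close>.\<close>

lemma representation_vanishing:
  assumes "M \<subseteq> zH2"
  shows "\<exists>N :: (real ^ 'n) hardy set.
    subspace N \<and> closed N \<and> (\<forall>H\<in>N. backward_shift H \<in> N) \<and>
    power_series ` M =
      {fps_X * (\<Sum>i\<in>UNIV. power_series (component i H) * power_series (e i)) | H. H \<in> N} \<and>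
    (\<forall>f\<in>M. \<forall>H\<in>N.
      power_series f = fps_X * (\<Sum>i\<in>UNIV. power_series (component i H) * power_series (e i)) \<longrightarrow>
      (norm f)\<^sup>2 = (\<Sum>i\<in>UNIV. (norm (component i H))\<^sup>2))"
proof -
  interpret hardy_leaking_contraction M near_shift near_shift_adj UNIV channel
      "\<lambda>i. forward_shift (e i)"
    by (rule hardy_leaking_contraction_vanishing[OF assms])
  define J where "J f = tuple (\<lambda>i. output_series i f)" for f
  have linear_J: "linear J"
    unfolding J_def[abs_def] by (rule linear_tuple) (rule linear_output_series[OF UNIV_I])
  have norm_J: "(norm f)\<^sup>2 = (\<Sum>i\<in>UNIV. (norm (component i (J f)))\<^sup>2)" if "f \<in> M" for f
    using norm_output_series[OF that] by (simp add: J_def component_tuple)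
  have iso: "norm (J f) = norm f" if "f \<in> M" for f
    using norm_J[OF that] by (simp flip: norm_components)
  have series: "fps_X * (\<Sum>i\<in>UNIV. power_series (component i (J f)) * power_series (e i))
      = power_series f" if "f \<in> M" for f
    using power_series_output_series[OF that]
    by (simp add: J_def component_tuple forward_shift.rep_eq sum_distrib_left mult_ac)
  show ?thesis
  proof (intro exI[of _ "J ` M"] conjI ballI impI)
    show "subspace (J ` M)" using linear_J subspace_M by (rule linear_subspace_image)
    show "closed (J ` M)" using subspace_M closed_M linear_J iso by (rule closed_isometric_image)
    show "backward_shift H \<in> J ` M" if "H \<in> J ` M" for H
      using that R_in by (auto simp: J_def backward_shift_tuple backward_shift_output_series)
    show "power_series ` M =
        {fps_X * (\<Sum>i\<in>UNIV. power_series (component i H) * power_series (e i)) | H. H \<in> J ` M}"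
      using series by force
    fix f H assume f: "f \<in> M" and "H \<in> J ` M"
      and eq: "power_series f = fps_X * (\<Sum>i\<in>UNIV. power_series (component i H) * power_series (e i))"
    then obtain f' where f': "f' \<in> M" "H = J f'" by blast
    then have "f = f'" using eq series[OF f'(1)] by (simp add: power_series_inject)
    then show "(norm f)\<^sup>2 = (\<Sum>i\<in>UNIV. (norm (component i H))\<^sup>2)" using norm_J f' by simp
  qed
qed

text \<open>The same argument with the additional channel along \<open>g\<close>.\<close>

lemma representation_normalized:
  assumes g: "normalized_at_0 M g"
  shows "\<exists>N :: (real hardy \<times> (real ^ 'n) hardy) set.
    subspace N \<and> closed N \<and>
    (\<forall>(h, H) \<in> N. (backward_shift h, backward_shift H) \<in> N) \<and>
    power_series ` M =
      {power_series g * power_series h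
         + fps_X * (\<Sum>i\<in>UNIV. power_series (component i H) * power_series (e i))
       | h H. (h, H) \<in> N} \<and>
    (\<forall>f\<in>M. \<forall>(h, H) \<in> N.
       power_series f = power_series g * power_series h
         + fps_X * (\<Sum>i\<in>UNIV. power_series (component i H) * power_series (e i)) \<longrightarrow>
       (norm f)\<^sup>2 = (norm h)\<^sup>2 + (\<Sum>i\<in>UNIV. (norm (component i H))\<^sup>2))"
proof -
  interpret hardy_leaking_contraction M near_shift near_shift_adj UNIV "case_option g channel"
      "case_option g (\<lambda>i. forward_shift (e i))"
    by (rule hardy_leaking_contraction_normalized[OF g])
  define h where "h f = output_series None f" for f
  define H where "H f = tuple (\<lambda>i. output_series (Some i) f)" for f
  define J where "J f = (h f, H f)" for f
  have linear_h: "linear h" unfolding h_def[abs_def] by (rule linear_output_series[OF UNIV_I])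
  have linear_H: "linear H"
    unfolding H_def[abs_def] by (rule linear_tuple) (rule linear_output_series[OF UNIV_I])
  have linear_J: "linear J"
    by (rule linearI) (simp_all add: J_def linear_add[OF linear_h] linear_add[OF linear_H]
        linear_scale[OF linear_h] linear_scale[OF linear_H])
  have norm_J: "(norm f)\<^sup>2 = (norm (h f))\<^sup>2 + (\<Sum>i\<in>UNIV. (norm (component i (H f)))\<^sup>2)"
    if "f \<in> M" for f
    using norm_output_series[OF that] unfolding sum_UNIV_option by (simp add: h_def H_def component_tuple)
  have iso: "norm (J f) = norm f" if "f \<in> M" for f
    unfolding J_def norm_Pair norm_components norm_J[OF that, symmetric] by simp
  have series: "power_series g * power_series (h f)
      + fps_X * (\<Sum>i\<in>UNIV. power_series (component i (H f)) * power_series (e i))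
      = power_series f" if "f \<in> M" for f
    using power_series_output_series[OF that] unfolding sum_UNIV_option
    by (simp add: h_def H_def component_tuple forward_shift.rep_eq sum_distrib_left mult_ac)
  show ?thesis
  proof (intro exI[of _ "J ` M"] conjI ballI impI)
    show "subspace (J ` M)" using linear_J subspace_M by (rule linear_subspace_image)
    show "closed (J ` M)" using subspace_M closed_M linear_J iso by (rule closed_isometric_image)
    show "case x of (h, H) \<Rightarrow> (backward_shift h, backward_shift H) \<in> J ` M" if "x \<in> J ` M" for x
      using that R_in
      by (auto simp: J_def h_def H_def backward_shift_tuple backward_shift_output_series)
    show "power_series ` M =
        {power_series g * power_series h
         + fps_X * (\<Sum>i\<in>UNIV. power_series (component i H) * power_series (e i))
         | h H. (h, H) \<in> J ` M}"
    proof (intro equalityI subsetI)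
      fix F assume "F \<in> power_series ` M"
      then obtain f where "f \<in> M" "F = power_series f" by blast
      then show "F \<in> {power_series g * power_series h
         + fps_X * (\<Sum>i\<in>UNIV. power_series (component i H) * power_series (e i))
         | h H. (h, H) \<in> J ` M}"
        using series[of f] by (auto simp: J_def intro!: exI[of _ "h f"] exI[of _ "H f"])
    qed (auto simp: J_def series)
    fix f x assume f: "f \<in> M" and "x \<in> J ` M"
    then obtain f' where f': "f' \<in> M" "x = (h f', H f')" by (auto simp: J_def)
    show "case x of (h, H) \<Rightarrow> power_series f = power_series g * power_series h
         + fps_X * (\<Sum>i\<in>UNIV. power_series (component i H) * power_series (e i)) \<longrightarrow>
       (norm f)\<^sup>2 = (norm h)\<^sup>2 + (\<Sum>i\<in>UNIV. (norm (component i H))\<^sup>2)"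
      using f' norm_J[OF f'(1)] series[OF f'(1)] by (auto simp: power_series_inject)
  qed
qed

end

theorem theorem4p4:
  fixes M D :: "real hardy set" and e :: "'n::finite \<Rightarrow> real hardy"
  assumes "subspace M" and "closed M" and "M \<noteq> {0}"
    and "nearly_invariant_with_defect M CARD('n)"
    and "defect_space M D" and "orthonormal_basis e D"
  shows
    "((\<exists>f\<in>M. fps_nth (power_series f) 0 \<noteq> 0) \<longrightarrow>
       (\<exists>!g. normalized_at_0 M g) \<and>
       (\<forall>g. normalized_at_0 M g \<longrightarrow>
         (\<exists>N :: (real hardy \<times> (real ^ 'n) hardy) set.
            subspace N \<and> closed N \<and>
            (\<forall>(h, H) \<in> N. (backward_shift h, backward_shift H) \<in> N) \<and>
            power_series ` M =
              {power_series g * power_series h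
                 + fps_X * (\<Sum>i\<in>UNIV. power_series (component i H) * power_series (e i))
               | h H. (h, H) \<in> N} \<and>
            (\<forall>f\<in>M. \<forall>(h, H) \<in> N.
               power_series f = power_series g * power_series h
                 + fps_X * (\<Sum>i\<in>UNIV. power_series (component i H) * power_series (e i)) \<longrightarrow>
               (norm f)\<^sup>2 = (norm h)\<^sup>2 + (\<Sum>i\<in>UNIV. (norm (component i H))\<^sup>2)))))
     \<and>
     ((\<forall>f\<in>M. fps_nth (power_series f) 0 = 0) \<longrightarrow>
       (\<exists>N :: (real ^ 'n) hardy set.
          subspace N \<and> closed N \<and>
          (\<forall>H\<in>N. backward_shift H \<in> N) \<and>
          power_series ` M =
            {fps_X * (\<Sum>i\<in>UNIV. power_series (component i H) * power_series (e i)) | H. H \<in> N} \<and>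
          (\<forall>f\<in>M. \<forall>H\<in>N.
             power_series f =
               fps_X * (\<Sum>i\<in>UNIV. power_series (component i H) * power_series (e i)) \<longrightarrow>
             (norm f)\<^sup>2 = (\<Sum>i\<in>UNIV. (norm (component i H))\<^sup>2))))"
proof -
  interpret nearly_invariant_subspace M D e
    using assms(1,2,5,6)
    by (intro nearly_invariant_subspace.intro) (simp_all only: defect_space_def)
  show ?thesis
  proof (intro conjI impI allI)
    assume "\<exists>f\<in>M. fps_nth (power_series f) 0 \<noteq> 0"
    then show "\<exists>!g. normalized_at_0 M g"
      using normalized_at_0_exists normalized_at_0_unique by blast
  next
    assume "\<forall>f\<in>M. fps_nth (power_series f) 0 = 0"
    then have "M \<subseteq> zH2" by (auto simp: mem_zH2_iff)
    then show "\<exists>N :: (real ^ 'n) hardy set.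
          subspace N \<and> closed N \<and>
          (\<forall>H\<in>N. backward_shift H \<in> N) \<and>
          power_series ` M =
            {fps_X * (\<Sum>i\<in>UNIV. power_series (component i H) * power_series (e i)) | H. H \<in> N} \<and>
          (\<forall>f\<in>M. \<forall>H\<in>N.
             power_series f =
               fps_X * (\<Sum>i\<in>UNIV. power_series (component i H) * power_series (e i)) \<longrightarrow>
             (norm f)\<^sup>2 = (\<Sum>i\<in>UNIV. (norm (component i H))\<^sup>2))"
      by (rule representation_vanishing)
  qed (rule representation_normalized)
qed

end
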